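(* Let $G$ be a countable (discrete) abelian group acting continuously on a compact metric space $X$, let $\mu$ be a $G$-invariant Borel probability measure on $X$, and fix a tempered Følner sequence $(F_n)$ in $G$. Suppose $(X,G,\mu)$ is minimal, uniquely ergodic, mixing of all orders, has minimal self-joinings of all orders, and has no weakly asymptotic pairs. Then $(X,G)$ is IC-rigid.
   Context: Let $d_X$ be the metric on $X$. Write $g^{\times N}(x_1,\dots,x_N)=(gx_1,\dots,gx_N)$. **Minimal / uniquely ergodic:** every orbit is dense / there is exactly one $G$-invariant Borel probability measure on $X$. **Mixing of all orders:** for every $N\ge1$ and Borel $A_0,\dots,A_N\subset X$, $\mu(g_0A_0\cap\dots\cap g_NA_N)\to\mu(A_0)\cdots\mu(A_N)$ as $g_i^{-1}g_j\to\infty$ for all $i\neq j$. **Joinings.** An $N$-fold self-joining is a $\{g^{\times N}\}_{g\in G}$-invariant Borel probability measure on $X^{\times N}$ with all one-coordinate marginals equal to $\mu$. Let ${}^N\Delta(A_1\times\dots\times A_N)=\mu(A_1\cap\dots\cap A_N)$, and for $\mathbf{g}=(g_1,\dots,g_N)\in G^N$ let ${}^N\Delta^{\mathbf g}=(g_1\times\dots\times g_N)_*{}^N\Delta$ (an off-diagonal joining, $G$ being abelian). A self-joining is trivial if, possibly after permuting coordinates, it is a direct product of off-diagonal joinings (including the one-fold joining $\mu$). The system has minimal self-joinings of all orders if for every $N\ge2$ every $N$-fold self-joining that is ergodic for $(X^{\times N},\{g^{\times N}\}_{g\in G})$ is trivial. **Weakly asymptotic pair.** For $D\subset G$ let $\bar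 d(D)=\limsup_n |F_n\cap D|/|F_n|$. Points $x\ne y$ of $X$ form a weakly asymptotic pair if there is $D\subset G$ with $\bar d(D)>0$ such that $d_X(gx,gy)\to0$ as $g\to\infty$ along $D$. **IC-rigidity.** $\mathcal{K}(X)$ is the space of nonempty compact subsets of $X$ with the Hausdorff metric and $\mathcal{K}_{\mathrm{fin}}(X)$ the set of nonempty finite subsets. $G$ acts on $\mathcal{K}(X)$ by $gK=\{gx:x\in K\}$. For discrete $G$, $(X,G)$ is IC-rigid if every $G$-invariant Borel probability measure $\nu$ on $\mathcal{K}(X)$ satisfies $\nu(\mathcal{K}_{\mathrm{fin}}(X)\cup\{X\})=1$, where $\{X\}$ is the one-element subset of $\mathcal{K}(X)$ whose element is $X$. *)

theory Defs
  imports "HOL-Probability.Probability"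
begin

section \<open>Compact metric spaces\<close>

class compact_metric_space = metric_space +
  assumes compact_UNIV_metric: "compact UNIV"

instance compact_metric_space \<subseteq> polish_space
proof
  show "convergent X" if "Cauchy X" for X :: "nat \<Rightarrow> 'a"
    using compact_imp_complete[OF compact_UNIV_metric] that
    by (auto simp: complete_def convergent_def)
next
  have "\<exists>F::'a set. finite F \<and> UNIV \<subseteq> (\<Union>x\<in>F. ball x (1 / Suc n))" for n
  proof -
    have "(UNIV :: 'a set) \<subseteq> (\<Union>x\<in>UNIV. ball x (1 / Suc n))"
      by (auto intro!: exI)
    then show ?thesis
      using compactE_image[OF compact_UNIV_metric, of UNIV "\<lambda>x::'a. ball x (1 / Suc n)"]
      by (metis open_ball top_greatest)
  qed
  then obtain F :: "nat \<Rightarrow> 'a set"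
    where F: "\<And>n. finite (F n)" "\<And>n. UNIV \<subseteq> (\<Union>x\<in>F n. ball x (1 / Suc n))"
    by metis
  define B where "B = (\<Union>n. (\<lambda>x. ball x (1 / Suc n)) ` F n)"
  have "topological_basis B"
  proof (rule topological_basisI)
    show "open U" if "U \<in> B" for U using that by (auto simp: B_def)
  next
    fix U :: "'a set" and x assume U: "open U" "x \<in> U"
    then obtain e where e: "e > 0" "ball x e \<subseteq> U" by (meson openE)
    obtain n where n: "1 / Suc n < e / 2"
      using e(1) nat_approx_posE[of "e / 2"] by auto
    obtain y where y: "y \<in> F n" "x \<in> ball y (1 / Suc n)" using F(2)[of n] by blast
    have "ball y (1 / Suc n) \<subseteq> ball x e"
    proof
      fix z assume "z \<in> ball y (1 / Suc n)"
      then show "z \<in> ball x e"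
        using y(2) n dist_triangle[of x z y] by (auto simp: dist_commute)
    qed
    then show "\<exists>V\<in>B. x \<in> V \<and> V \<subseteq> U" using y e by (auto simp: B_def)
  qed
  moreover have "countable B" using F(1) by (auto simp: B_def intro: countable_finite)
  ultimately show "\<exists>B::'a set set. countable B \<and> open = generate_topology B"
    using topological_basis_imp_subbasis[of B] by blast
qed


section \<open>The hyperspace of nonempty compact sets\<close>

typedef (overloaded) 'a hyperspace = "{K :: 'a::metric_space set. compact K \<and> K \<noteq> {}}"
  morphisms set_of_hyperspace Abs_hyperspace
  by (rule exI[of _ "{undefined}"]) simp

lemma compact_set_of [simp]: "compact (set_of_hyperspace K)"
  and nonempty_set_of [simp]: "set_of_hyperspace K \<noteq> {}"
  using set_of_hyperspace[of K] by auto

lemma bdd_above_infdist: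
  "bdd_above ((\<lambda>x. infdist x (set_of_hyperspace L)) ` set_of_hyperspace K)"
  by (intro bounded_imp_bdd_above compact_imp_bounded compact_continuous_image
      continuous_intros) simp

instantiation hyperspace :: (metric_space) metric_space
begin

text \<open>The Hausdorff metric.\<close>

definition dist_hyperspace :: "'a hyperspace \<Rightarrow> 'a hyperspace \<Rightarrow> real" where
  "dist_hyperspace K L =
     max (SUP x\<in>set_of_hyperspace K. infdist x (set_of_hyperspace L))
         (SUP y\<in>set_of_hyperspace L. infdist y (set_of_hyperspace K))"

definition uniformity_hyperspace :: "('a hyperspace \<times> 'a hyperspace) filter" where
  "uniformity_hyperspace = (INF e\<in>{0<..}. principal {(K, L). dist K L < e})"

definition open_hyperspace :: "'a hyperspace set \<Rightarrow> bool" where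
  "open_hyperspace U \<longleftrightarrow>
     (\<forall>K\<in>U. eventually (\<lambda>(K', L). K' = K \<longrightarrow> L \<in> U) uniformity)"

lemma infdist_le_dist_hyperspace:
  assumes "x \<in> set_of_hyperspace K"
  shows "infdist x (set_of_hyperspace L) \<le> dist K L"
  using cSUP_upper[OF assms bdd_above_infdist[of L K]] by (simp add: dist_hyperspace_def)

lemma dist_hyperspace_le:
  assumes "\<And>x. x \<in> set_of_hyperspace K \<Longrightarrow> infdist x (set_of_hyperspace L) \<le> r"
    and "\<And>y. y \<in> set_of_hyperspace L \<Longrightarrow> infdist y (set_of_hyperspace K) \<le> r"
  shows "dist K L \<le> r"
  using assms by (auto simp: dist_hyperspace_def intro!: cSUP_least)

lemma dist_hyperspace_commute: "dist K L = dist L (K :: 'a hyperspace)"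
  by (simp add: dist_hyperspace_def max.commute)

instance
proof
  fix K L M :: "'a hyperspace"
  show "dist K L = 0 \<longleftrightarrow> K = L"
  proof
    assume 0: "dist K L = 0"
    have sub: "set_of_hyperspace A \<subseteq> set_of_hyperspace B" if "dist A B = 0"
      for A B :: "'a hyperspace"
    proof
      fix x assume "x \<in> set_of_hyperspace A"
      then have "infdist x (set_of_hyperspace B) = 0"
        using infdist_le_dist_hyperspace[of x A B] that infdist_nonneg[of x] by (metis antisym)
      then show "x \<in> set_of_hyperspace B"
        by (simp add: in_closed_iff_infdist_zero compact_imp_closed)
    qed
    show "K = L"
      using sub[OF 0] sub[of L K] 0 by (simp add: dist_hyperspace_commute set_of_hyperspace_inject)
  next
    assume "K = L"
    then show "dist K L = 0" by (simp add: dist_hyperspace_def)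
  qed
  have half: "infdist x (set_of_hyperspace B) \<le> dist A C + dist B C"
    if "x \<in> set_of_hyperspace A" for x and A B C :: "'a hyperspace"
  proof -
    have "infdist x (set_of_hyperspace B) - dist C B \<le> dist x y" if "y \<in> set_of_hyperspace C" for y
      using infdist_triangle[of x "set_of_hyperspace B" y] infdist_le_dist_hyperspace[OF that, of B]
      by linarith
    then have "infdist x (set_of_hyperspace B) - dist C B \<le> infdist x (set_of_hyperspace C)"
      by (simp add: infdist_notempty cINF_greatest)
    also have "\<dots> \<le> dist A C"
      using that by (rule infdist_le_dist_hyperspace)
    finally show ?thesis by (simp add: dist_hyperspace_commute[of C B])
  qed
  show "dist K L \<le> dist K M + dist L M"
    using half[of _ K L M] half[of _ L K M] by (intro dist_hyperspace_le) (auto simp: add.commute)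
qed (simp_all only: uniformity_hyperspace_def open_hyperspace_def)

end

definition image_hyperspace :: "('a::metric_space \<Rightarrow> 'b::metric_space) \<Rightarrow> 'a hyperspace \<Rightarrow> 'b hyperspace"
  where "image_hyperspace f K = Abs_hyperspace (f ` set_of_hyperspace K)"

lemma set_of_image_hyperspace:
  assumes "continuous_on UNIV f"
  shows "set_of_hyperspace (image_hyperspace f K) = f ` set_of_hyperspace K"
  unfolding image_hyperspace_def
  by (rule Abs_hyperspace_inverse)
     (auto intro!: compact_continuous_image continuous_on_subset[OF assms])


lemma hyperspace_nearby:
  assumes "x \<in> set_of_hyperspace K" "dist K L < e"
  obtains y where "y \<in> set_of_hyperspace L" "dist x y < e"
proof -
  have "infdist x (set_of_hyperspace L) < e"
    using infdist_le_dist_hyperspace[OF assms(1), of L] assms(2) by linarith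
  then have "(INF y\<in>set_of_hyperspace L. dist x y) < e" by (simp add: infdist_notempty)
  then show ?thesis using that
    by (subst (asm) cINF_less_iff) (auto intro: bdd_belowI2[of _ 0])
qed

lemma dist_hyperspace_leI:
  assumes "\<And>x. x \<in> set_of_hyperspace K \<Longrightarrow> \<exists>y\<in>set_of_hyperspace L. dist x y \<le> r"
    and "\<And>y. y \<in> set_of_hyperspace L \<Longrightarrow> \<exists>x\<in>set_of_hyperspace K. dist y x \<le> r"
  shows "dist K L \<le> r"
proof (rule dist_hyperspace_le)
  show "infdist x (set_of_hyperspace L) \<le> r" if "x \<in> set_of_hyperspace K" for x
    using assms(1)[OF that] by (blast intro: infdist_le2)
  show "infdist y (set_of_hyperspace K) \<le> r" if "y \<in> set_of_hyperspace L" for y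
    using assms(2)[OF that] by (blast intro: infdist_le2)
qed

lemma continuous_image_hyperspace:
  fixes f :: "'a::compact_metric_space \<Rightarrow> 'b::metric_space"
  assumes f: "continuous_on UNIV f"
  shows "continuous_on UNIV (image_hyperspace f)"
proof -
  have uc: "uniformly_continuous_on UNIV f"
    using f compact_UNIV_metric by (rule compact_uniformly_continuous)
  show ?thesis
    unfolding continuous_on_iff
  proof (intro ballI allI impI)
    fix K :: "'a hyperspace" and e :: real assume "0 < e"
    then have "0 < e / 2" by simp
    then obtain d where d: "d > 0" "\<And>x y. dist y x < d \<Longrightarrow> dist (f y) (f x) < e / 2"
      using uniformly_continuous_onE[OF uc] by (metis UNIV_I)
    have "dist (image_hyperspace f L) (image_hyperspace f K) < e" if LK: "dist L K < d" for L
    proof -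
      have KL: "dist K L < d" using LK by (simp add: dist_commute)
      have half: "\<exists>y'\<in>set_of_hyperspace (image_hyperspace f B). dist x' y' \<le> e / 2"
        if x': "x' \<in> set_of_hyperspace (image_hyperspace f A)" and AB: "dist A B < d" for x' A B
      proof -
        obtain x where x: "x \<in> set_of_hyperspace A" "x' = f x"
          using x' by (auto simp: set_of_image_hyperspace[OF f])
        obtain y where "y \<in> set_of_hyperspace B" "dist x y < d"
          using hyperspace_nearby[OF x(1) AB] .
        then show ?thesis
          using d(2)[of x y] x(2) by (intro bexI[of _ "f y"]) (auto simp: set_of_image_hyperspace[OF f])
      qed
      have "dist (image_hyperspace f L) (image_hyperspace f K) \<le> e / 2"
        using half LK KL by (intro dist_hyperspace_leI) blast+
      then show ?thesis using \<open>0 < e\<close> by linarith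
    qed
    then show "\<exists>d>0. \<forall>L\<in>UNIV. dist L K < d \<longrightarrow> dist (image_hyperspace f L) (image_hyperspace f K) < e"
      using d(1) by blast
  qed
qed

lemma closed_card_le_hyperspace:
  "closed {K :: 'a::metric_space hyperspace.
     finite (set_of_hyperspace K) \<and> card (set_of_hyperspace K) \<le> n}"
proof -
  have "open {K :: 'a hyperspace.
     \<not> (finite (set_of_hyperspace K) \<and> card (set_of_hyperspace K) \<le> n)}"
    unfolding open_dist
  proof (intro ballI)
    fix K :: "'a hyperspace"
    assume "K \<in> {K. \<not> (finite (set_of_hyperspace K) \<and> card (set_of_hyperspace K) \<le> n)}"
    then obtain S where S: "S \<subseteq> set_of_hyperspace K" "finite S" "card S = Suc n"
    proof (cases "finite (set_of_hyperspace K)")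
      case True
      then have "Suc n \<le> card (set_of_hyperspace K)"
        using \<open>K \<in> _\<close> by simp
      then show ?thesis by (rule obtain_subset_with_card_n) (rule that)
    next
      case False
      then show ?thesis using infinite_arbitrarily_large[OF False, of "Suc n"] that by metis
    qed
    define D where "D = insert 1 ((\<lambda>(x, y). dist x y) ` {(x, y) \<in> S \<times> S. x \<noteq> y})"
    define e where "e = Min D / 2"
    have fin: "finite D"
      unfolding D_def case_prod_unfold using S(2) by (intro finite.insertI finite_imageI) simp
    have "Min D > 0"
      by (subst Min_gr_iff) (use fin in \<open>auto simp: D_def\<close>)
    then have e: "e > 0" by (simp add: e_def)
    have sep: "2 * e \<le> dist x y" if "x \<in> S" "y \<in> S" "x \<noteq> y" for x y
      using that fin by (auto simp: e_def D_def intro!: Min_le)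
    have "\<not> (finite (set_of_hyperspace L) \<and> card (set_of_hyperspace L) \<le> n)"
      if "dist L K < e" for L
    proof -
      have "\<exists>y. y \<in> set_of_hyperspace L \<and> dist x y < e" if "x \<in> S" for x
        using hyperspace_nearby[of x K L e] S(1) that \<open>dist L K < e\<close>
        by (metis dist_commute subsetD)
      then obtain h where h: "\<And>x. x \<in> S \<Longrightarrow> h x \<in> set_of_hyperspace L \<and> dist x (h x) < e"
        by metis
      have "inj_on h S"
      proof (rule inj_onI, rule ccontr)
        fix x y assume xy: "x \<in> S" "y \<in> S" "h x = h y" "x \<noteq> y"
        then show False
          using sep[OF xy(1,2,4)] h[OF xy(1)] h[OF xy(2)] dist_triangle2[of x y "h x"] by auto
      qed
      then have "finite (set_of_hyperspace L) \<Longrightarrow> Suc n \<le> card (set_of_hyperspace L)"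
        using card_inj_on_le[of h S "set_of_hyperspace L"] h S(3) by auto
      then show ?thesis by auto
    qed
    then show "\<exists>e>0. \<forall>L. dist L K < e \<longrightarrow>
        L \<in> {K. \<not> (finite (set_of_hyperspace K) \<and> card (set_of_hyperspace K) \<le> n)}"
      using e by blast
  qed
  then show ?thesis by (simp add: closed_def Compl_eq)
qed

lemma borel_finite_or_UNIV_hyperspace:
  "{K :: 'a::metric_space hyperspace.
     finite (set_of_hyperspace K) \<or> set_of_hyperspace K = UNIV} \<in> sets borel"
proof -
  let ?U = "{K :: 'a hyperspace. set_of_hyperspace K = UNIV}"
  have "K = Abs_hyperspace UNIV" if "K \<in> ?U" for K
    using that set_of_hyperspace_inverse[of K] by simp
  then have "finite ?U"
    by (intro finite_subset[of ?U "{Abs_hyperspace UNIV}"] subsetI) auto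
  then have "?U \<in> sets borel" by (intro borel_closed finite_imp_closed)
  moreover have "(\<Union>n. {K :: 'a hyperspace.
      finite (set_of_hyperspace K) \<and> card (set_of_hyperspace K) \<le> n}) \<in> sets borel"
    by (intro sets.countable_UN) (auto intro: borel_closed closed_card_le_hyperspace)
  ultimately have "(\<Union>n. {K :: 'a hyperspace.
      finite (set_of_hyperspace K) \<and> card (set_of_hyperspace K) \<le> n}) \<union> ?U \<in> sets borel"
    by blast
  also have "(\<Union>n. {K :: 'a hyperspace.
      finite (set_of_hyperspace K) \<and> card (set_of_hyperspace K) \<le> n}) \<union> ?U =
      {K. finite (set_of_hyperspace K) \<or> set_of_hyperspace K = UNIV}"
    by auto
  finally show ?thesis .
qed


section \<open>Actions and invariant measures\<close>

definition continuous_action :: "('g::group_add \<Rightarrow> 'x::topological_space \<Rightarrow> 'x) \<Rightarrow> bool" where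
  "continuous_action act \<longleftrightarrow>
     (\<forall>x. act 0 x = x) \<and> (\<forall>g h x. act (g + h) x = act g (act h x)) \<and>
     (\<forall>g. continuous_on UNIV (act g))"

definition invariant_prob :: "'a measure \<Rightarrow> ('g \<Rightarrow> 'a \<Rightarrow> 'a) \<Rightarrow> 'a measure \<Rightarrow> bool" where
  "invariant_prob M T \<nu> \<longleftrightarrow>
     sets \<nu> = sets M \<and> prob_space \<nu> \<and> (\<forall>g. T g \<in> measurable M M \<and> distr \<nu> M (T g) = \<nu>)"

definition ergodic_for :: "('g \<Rightarrow> 'a \<Rightarrow> 'a) \<Rightarrow> 'a measure \<Rightarrow> bool" where
  "ergodic_for T \<nu> \<longleftrightarrow>
     (\<forall>A\<in>sets \<nu>. (\<forall>g. T g -` A \<inter> space \<nu> = A) \<longrightarrow> measure \<nu> A = 0 \<or> measure \<nu> A = 1)"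

definition minimal_action :: "('g \<Rightarrow> 'x::topological_space \<Rightarrow> 'x) \<Rightarrow> bool" where
  "minimal_action act \<longleftrightarrow> (\<forall>x. closure (range (\<lambda>g. act g x)) = UNIV)"

definition uniquely_ergodic :: "('g \<Rightarrow> 'x::topological_space \<Rightarrow> 'x) \<Rightarrow> bool" where
  "uniquely_ergodic act \<longleftrightarrow> (\<exists>!\<nu>. invariant_prob borel act \<nu>)"

text \<open>The filter below expresses that \<open>g j - g i\<close> leaves every finite subset of the group,
  for each pair of distinct indices.\<close>

definition mixing_all_orders ::
    "('g::group_add \<Rightarrow> 'x::topological_space \<Rightarrow> 'x) \<Rightarrow> 'x measure \<Rightarrow> bool" where
  "mixing_all_orders act \<mu> \<longleftrightarrow>
     (\<forall>N\<ge>1. \<forall>A :: nat \<Rightarrow> 'x set. (\<forall>i\<le>N. A i \<in> sets borel) \<longrightarrow>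
        ((\<lambda>g :: nat \<Rightarrow> 'g. measure \<mu> (\<Inter>i\<le>N. act (g i) ` A i))
           \<longlongrightarrow> (\<Prod>i\<le>N. measure \<mu> (A i)))
        (INF (i, j)\<in>{(i, j). i \<le> N \<and> j \<le> N \<and> i \<noteq> j}.
           filtercomap (\<lambda>g. - g i + g j) cofinite))"


section \<open>Self-joinings\<close>

definition diagonal_act :: "'i set \<Rightarrow> ('g \<Rightarrow> 'x \<Rightarrow> 'x) \<Rightarrow> 'g \<Rightarrow> ('i \<Rightarrow> 'x) \<Rightarrow> 'i \<Rightarrow> 'x" where
  "diagonal_act I act g x = (\<lambda>i\<in>I. act g (x i))"

definition self_joining ::
    "('g \<Rightarrow> 'x::topological_space \<Rightarrow> 'x) \<Rightarrow> 'x measure \<Rightarrow> nat \<Rightarrow> (nat \<Rightarrow> 'x) measure \<Rightarrow> bool" where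
  "self_joining act \<mu> N \<rho> \<longleftrightarrow>
     invariant_prob (PiM {..<N} (\<lambda>_. borel)) (diagonal_act {..<N} act) \<rho> \<and>
     (\<forall>i<N. distr \<rho> borel (\<lambda>x. x i) = \<mu>)"

definition diagonal_joining :: "'x::topological_space measure \<Rightarrow> 'i set \<Rightarrow> ('i \<Rightarrow> 'x) measure" where
  "diagonal_joining \<mu> I = distr \<mu> (PiM I (\<lambda>_. borel)) (\<lambda>x. \<lambda>i\<in>I. x)"

lemma emeasure_diagonal_joining:
  assumes "sets \<mu> = sets borel" "finite I" "I \<noteq> {}" "\<And>i. i \<in> I \<Longrightarrow> A i \<in> sets borel"
  shows "emeasure (diagonal_joining \<mu> I) (PiE I A) = emeasure \<mu> (\<Inter>i\<in>I. A i)"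
proof -
  have *: "(\<lambda>x. \<lambda>i\<in>I. x) \<in> measurable \<mu> (PiM I (\<lambda>_. borel))"
    by (rule measurable_restrict) (simp add: measurable_def assms(1) sets_eq_imp_space_eq[OF assms(1)])
  have "(\<lambda>x. \<lambda>i\<in>I. x) -` PiE I A \<inter> space \<mu> = (\<Inter>i\<in>I. A i)"
    using assms(3) sets_eq_imp_space_eq[OF assms(1)] by auto
  then show ?thesis
    unfolding diagonal_joining_def
    by (subst emeasure_distr[OF *]) (auto intro: sets_PiM_I_finite assms)
qed

definition off_diagonal_joining ::
    "('g \<Rightarrow> 'x::topological_space \<Rightarrow> 'x) \<Rightarrow> 'x measure \<Rightarrow> 'i set \<Rightarrow> ('i \<Rightarrow> 'g) \<Rightarrow> ('i \<Rightarrow> 'x) measure"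
  where
  "off_diagonal_joining act \<mu> I g =
     distr (diagonal_joining \<mu> I) (PiM I (\<lambda>_. borel)) (\<lambda>x. \<lambda>i\<in>I. act (g i) (x i))"

text \<open>The coordinates \<open>{..<N}\<close> are partitioned into \<open>k\<close> nonempty blocks, \<open>b i\<close> being the block of
  coordinate \<open>i\<close>; each block carries an off-diagonal joining, and the blocks are independent.
  The blocks need not be intervals, which accounts for the permutation of coordinates.\<close>

definition trivial_joining ::
    "('g \<Rightarrow> 'x::topological_space \<Rightarrow> 'x) \<Rightarrow> 'x measure \<Rightarrow> nat \<Rightarrow> (nat \<Rightarrow> 'x) measure \<Rightarrow> bool" where
  "trivial_joining act \<mu> N \<rho> \<longleftrightarrow>
     (\<exists>(k::nat) b g. b ` {..<N} = {..<k} \<and>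
        \<rho> = distr (PiM {..<k} (\<lambda>j. off_diagonal_joining act \<mu> {i. i < N \<and> b i = j} g))
                  (PiM {..<N} (\<lambda>_. borel)) (\<lambda>w. \<lambda>i\<in>{..<N}. w (b i) i))"

definition minimal_self_joinings ::
    "('g \<Rightarrow> 'x::topological_space \<Rightarrow> 'x) \<Rightarrow> 'x measure \<Rightarrow> bool" where
  "minimal_self_joinings act \<mu> \<longleftrightarrow>
     (\<forall>N\<ge>2. \<forall>\<rho>. self_joining act \<mu> N \<rho> \<longrightarrow> ergodic_for (diagonal_act {..<N} act) \<rho> \<longrightarrow>
        trivial_joining act \<mu> N \<rho>)"


section \<open>Folner sequences and weakly asymptotic pairs\<close>

definition folner_sequence :: "(nat \<Rightarrow> 'g::group_add set) \<Rightarrow> bool" where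
  "folner_sequence F \<longleftrightarrow>
     (\<forall>n. finite (F n) \<and> F n \<noteq> {}) \<and>
     (\<forall>g. (\<lambda>n. real (card (sym_diff ((+) g ` F n) (F n))) / real (card (F n))) \<longlonglongrightarrow> 0)"

definition tempered :: "(nat \<Rightarrow> 'g::group_add set) \<Rightarrow> bool" where
  "tempered F \<longleftrightarrow>
     (\<exists>C::real. \<forall>n. real (card (\<Union>k<n. {- h + g |h g. h \<in> F k \<and> g \<in> F n})) \<le> C * real (card (F n)))"

definition upper_density :: "(nat \<Rightarrow> 'g set) \<Rightarrow> 'g set \<Rightarrow> ereal" where
  "upper_density F D = limsup (\<lambda>n. ereal (real (card (F n \<inter> D)) / real (card (F n))))"

definition weakly_asymptotic ::
    "(nat \<Rightarrow> 'g set) \<Rightarrow> ('g \<Rightarrow> 'x::metric_space \<Rightarrow> 'x) \<Rightarrow> 'x \<Rightarrow> 'x \<Rightarrow> bool" where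
  "weakly_asymptotic F act x y \<longleftrightarrow>
     x \<noteq> y \<and> (\<exists>D. upper_density F D > 0 \<and>
       ((\<lambda>g. dist (act g x) (act g y)) \<longlongrightarrow> 0) (inf cofinite (principal D)))"


section \<open>IC-rigidity\<close>

definition IC_rigid :: "('g \<Rightarrow> 'x::metric_space \<Rightarrow> 'x) \<Rightarrow> bool" where
  "IC_rigid act \<longleftrightarrow>
     (\<forall>\<nu>. invariant_prob borel (\<lambda>g. image_hyperspace (act g)) \<nu> \<longrightarrow>
        measure \<nu> {K. finite (set_of_hyperspace K) \<or> set_of_hyperspace K = UNIV} = 1)"

end

theory Submission
  imports Defs
begin

text \<open>
  The proof replaces invariant random compact sets by a deterministic statement about one infinite
  set \<open>K\<close>: for every nonempty open \<open>U\<close>, the group elements \<open>g\<close> with \<open>gK \<inter> U = {}\<close> have density zero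
  along the Folner sequence (\<open>infinite_set_misses_open_set_rarely\<close>). Given this, let \<open>\<nu>\<close> be an
  invariant measure on the hyperspace. By invariance, the \<open>\<nu>\<close>-measure of the infinite sets missing \<open>U\<close>
  equals the integral of the frequency with which the orbit of an infinite set misses \<open>U\<close>, and
  this tends to \<open>0\<close> by dominated convergence: the statement about \<open>K\<close> holds for every infinite set, so
  the frequencies converge pointwise. Letting \<open>U\<close> run through a countable basis, almost every
  infinite set meets every basic open set and, being closed, is the whole space.

  The statement about \<open>K\<close> is a second moment argument. Let \<open>f\<close> be a continuous function below the
  indicator of \<open>U\<close> with integral close to \<open>q = \<mu> U > 0\<close>. If points \<open>x 0, \<dots>, x (N - 1)\<close> of \<open>K\<close> are such
  that the averages of \<open>f (g (x i)) * f (g (x j))\<close> stay below \<open>q\<^sup>2\<close> plus a small error for \<open>i \<noteq> j\<close>,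
  then by Chebyshev's inequality, for large \<open>N\<close>, the function \<open>f\<close> vanishes at all the points \<open>g (x i)\<close>
  only for a set of \<open>g\<close> of small density. So it suffices that for every point \<open>x\<close> all but finitely many points \<open>y\<close> satisfy this
  correlation bound (\<open>pair_average_bound\<close>): points of \<open>K\<close> can then be chosen one after the other.

  The correlation bound is where the dynamical hypotheses meet. Limits of the empirical measures of
  the orbit of \<open>(x, y)\<close> are invariant measures on the square, that is, two-fold self-joinings, but
  they need not be ergodic. By minimal self-joinings an ergodic one is either the product
  measure, for which the correlation is at most \<open>q\<^sup>2\<close>, or it lives on a graph
  \<open>{(x, s x)}\<close>, for which by mixing the correlation is at most \<open>q\<^sup>2\<close> plus a small error
  unless \<open>s\<close> lies in a finite set \<open>S\<close>. The function \<open>f \<otimes> f\<close> is multiplied by a continuous cutoff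
  that vanishes on the graphs with \<open>s \<in> S\<close>; the bound then holds for every ergodic joining. It
  passes to all invariant measures, and hence to the averages along orbits
  (\<open>folner_average_le_ergodic_bound\<close>). Finally, the cutoff costs little: for \<open>y \<noteq> s x\<close> the absence of
  weakly asymptotic pairs says that the orbits of \<open>s x\<close> and \<open>y\<close> are rarely close. The exceptional
  points are therefore \<open>s x\<close> with \<open>s \<in> S\<close>, finitely many.

  The passage from ergodic to arbitrary invariant measures is an instance of Bauer's maximum
  principle (\<open>integral_bound_from_ergodic\<close>): a strictly convex, weakly continuous functional attains
  its maximum over the invariant measures, and any maximiser is ergodic. It rests on the weak
  sequential compactness of the probability measures on a compact metric space
  (\<open>weak_limit_exists\<close>).
\<close>

section \<open>Weak limits of probability measures on a compact metric space\<close>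

lemma countable_convergent_subsequence:
  fixes a :: "nat \<Rightarrow> 'i \<Rightarrow> real"
  assumes "countable E" "\<And>n i. i \<in> E \<Longrightarrow> a n i \<in> {0..1}"
  obtains r :: "nat \<Rightarrow> nat" where "strict_mono r" "\<And>i. i \<in> E \<Longrightarrow> convergent (\<lambda>n. a (r n) i)"
proof (cases "E = {}")
  case True
  then show ?thesis using that[of id] by (auto simp: strict_mono_def)
next
  case False
  define e where "e = from_nat_into E"
  have e: "range e = E" unfolding e_def using False assms(1) by (rule range_from_nat_into)
  have "compactin (product_topology (\<lambda>_::nat. euclideanreal) UNIV) (PiE UNIV (\<lambda>_. {0..1}))"
    by (subst compactin_PiE) auto
  then have "compact (PiE UNIV (\<lambda>_. {0..1}) :: (nat \<Rightarrow> real) set)"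
    by (simp add: euclidean_product_topology)
  then have "seq_compact (PiE UNIV (\<lambda>_. {0..1}) :: (nat \<Rightarrow> real) set)"
    by (rule compact_imp_seq_compact)
  moreover have "\<forall>n. (\<lambda>k. a n (e k)) \<in> PiE UNIV (\<lambda>_. {0..1})"
    using assms(2) e by (auto simp: PiE_UNIV_domain)
  ultimately obtain l r where r: "strict_mono r" "((\<lambda>n k. a n (e k)) \<circ> r) \<longlonglongrightarrow> l"
    by (auto elim!: seq_compactE)
  have "(\<lambda>n. a (r n) (e k)) \<longlonglongrightarrow> l k" for k
    using continuous_on_tendsto_compose[OF continuous_on_product_coordinates r(2)]
    by (simp add: o_def)
  then show ?thesis using that[of r] r(1) e by (auto simp: convergent_def)
qed

text \<open>
  One level of a coding of the points of a compact space by sequences of reals: the code \<open>c z\<close> takes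
  finitely many values and determines \<open>z\<close> up to \<open>e\<close> through the decoding \<open>d\<close>.
\<close>
lemma finite_borel_coding:
  assumes compact: "compact (UNIV :: 'z::{metric_space, second_countable_topology} set)" and "e > 0"
  obtains c :: "'z::{metric_space, second_countable_topology} \<Rightarrow> real" and d :: "real \<Rightarrow> 'z"
  where "c \<in> borel_measurable borel" "d \<in> borel_measurable borel" "finite (range c)"
    "\<And>z. dist (d (c z)) z < e"
proof -
  have "(UNIV :: 'z set) \<subseteq> (\<Union>x\<in>UNIV. ball x e)" using \<open>e > 0\<close> by auto
  then obtain Q :: "'z set" where Q: "finite Q" "UNIV \<subseteq> (\<Union>x\<in>Q. ball x e)"
    using compactE_image[OF compact, of UNIV "\<lambda>x::'z. ball x e"]
    by (metis open_ball top_greatest)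
  then obtain N and q :: "nat \<Rightarrow> 'z" where q: "Q = q ` {i. i < N}"
    using finite_imp_nat_seg_image_inj_on by metis
  define c where "c z = (LEAST i. dist (q i) z < e)" for z
  have ex: "\<exists>i<N. dist (q i) z < e" for z using Q(2) q by (force simp: subset_iff)
  have dist_c: "dist (q (c z)) z < e" for z unfolding c_def using ex by (metis (mono_tags, lifting) LeastI)
  have c_less: "c z < N" for z
    using ex[of z] unfolding c_def by (meson Least_le le_less_trans)
  have c_m: "c \<in> measurable borel (count_space UNIV)" unfolding c_def by measurable
  show thesis
  proof (rule that[of "\<lambda>z. real (c z)" "\<lambda>t. q (nat \<lfloor>t\<rfloor>)"])
    show "(\<lambda>z. real (c z)) \<in> borel_measurable borel" using c_m by measurable
    have "(\<lambda>t::real. nat \<lfloor>t\<rfloor>) \<in> measurable borel (count_space UNIV)" by measurable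
    then show "(\<lambda>t::real. q (nat \<lfloor>t\<rfloor>)) \<in> borel_measurable borel"
      by (rule measurable_compose[where g = q]) simp
    have "range (\<lambda>z. real (c z)) \<subseteq> real ` {..<N}" using c_less by auto
    then show "finite (range (\<lambda>z. real (c z)))" by (rule finite_subset) simp
    show "dist (q (nat \<lfloor>real (c z)\<rfloor>)) z < e" for z using dist_c by simp
  qed
qed

text \<open>The sum of the geometric series of step lengths is at most \<open>4 * (1/2)^m\<close> from step \<open>m\<close> on.\<close>
lemma dist_le_of_geometric_steps:
  assumes "\<And>m. dist (w m) (w (Suc m)) \<le> 2 * (1/2)^m"
  shows "dist (w m) (w (m + k)) \<le> 4 * (1/2::real)^m"
proof -
  have "dist (w m) (w (m + k)) \<le> 4 * (1/2::real)^m - 4 * (1/2)^(m+k)"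
  proof (induction k)
    case (Suc k)
    have "dist (w m) (w (m + Suc k)) \<le> dist (w m) (w (m + k)) + dist (w (m+k)) (w (Suc (m+k)))"
      by (metis add_Suc_right dist_triangle)
    also have "\<dots> \<le> (4 * (1/2)^m - 4 * (1/2)^(m+k)) + 2 * (1/2)^(m+k)"
      by (intro add_mono Suc assms)
    finally show ?case by simp
  qed simp
  moreover have "(0::real) \<le> 4 * (1/2)^(m+k)" by simp
  ultimately show ?thesis by linarith
qed

lemma continuous_on_compact_bounded:
  fixes f :: "'z::metric_space \<Rightarrow> real"
  assumes "compact (UNIV :: 'z set)" "continuous_on UNIV f"
  obtains B where "\<And>z. \<bar>f z\<bar> \<le> B"
proof -
  have "bounded (f ` UNIV)"
    using assms by (intro compact_imp_bounded compact_continuous_image)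
  then show ?thesis using that by (auto simp: bounded_iff)
qed

lemma (in prob_space) integral_close:
  fixes f g :: "'a \<Rightarrow> real"
  assumes "integrable M f" "integrable M g" "AE x in M. \<bar>f x - g x\<bar> \<le> e"
  shows "\<bar>integral\<^sup>L M f - integral\<^sup>L M g\<bar> \<le> e"
proof -
  have "\<bar>integral\<^sup>L M f - integral\<^sup>L M g\<bar> \<le> integral\<^sup>L M (\<lambda>x. \<bar>f x - g x\<bar>)"
    using integral_abs_bound[of M "\<lambda>x. f x - g x"] assms by simp
  also have "\<dots> \<le> integral\<^sup>L M (\<lambda>x. e)"
    using assms by (intro integral_mono_AE) auto
  finally show ?thesis by (simp add: prob_space)
qed

lemma (in prob_space) integral_AE_finite_range:
  fixes f :: "'b \<Rightarrow> real"
  assumes R: "finite R" "AE x in M. h x \<in> R"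
    and h: "\<And>v. {x \<in> space M. h x = v} \<in> events" and f: "(\<lambda>x. f (h x)) \<in> borel_measurable M"
  shows "expectation (\<lambda>x. f (h x)) = (\<Sum>v\<in>R. f v * prob {x \<in> space M. h x = v})"
proof -
  have "f (h x) = (\<Sum>v\<in>R. f v * indicator {x \<in> space M. h x = v} x)"
    if "h x \<in> R" "x \<in> space M" for x
    using that R(1) by (simp add: indicator_def sum.delta' if_distrib cong: if_cong)
  then have "expectation (\<lambda>x. f (h x)) = expectation (\<lambda>x. \<Sum>v\<in>R. f v * indicator {x \<in> space M. h x = v} x)"
    using R(2) h f by (intro integral_cong_AE) auto
  also have "\<dots> = (\<Sum>v\<in>R. expectation (\<lambda>x. f v * indicator {x \<in> space M. h x = v} x))"
    using h by (intro Bochner_Integration.integral_sum integrable_mult_right)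
       (simp add: integrable_real_indicator less_top[symmetric])
  also have "\<dots> = (\<Sum>v\<in>R. f v * prob {x \<in> space M. h x = v})"
    using h by (intro sum.cong) (simp_all add: Int_absorb2[OF sets.sets_into_space])
  finally show ?thesis .
qed

text \<open>
  Sequential compactness of the probability measures on a compact metric space. Code each point
  by a sequence of reals whose \<open>m\<close>-th entry takes finitely many values and determines the point up to
  \<open>(1/2)^m\<close>. The events that depend on finitely many entries form a countable family up to finite
  unions, so along a subsequence all their probabilities converge. The limits are finitely
  supported, projectively consistent laws, hence the marginals of a measure \<open>Q\<close> on code sequences by
  Kolmogorov's extension theorem. Almost every code sequence is decoded to a Cauchy sequence; the
  law of its limit is the weak limit. The compactness of the space is an explicit hypothesis, so
  that the theorem applies to the square of a compact space.
\<close>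
theorem weak_limit_exists:
  fixes \<mu> :: "nat \<Rightarrow> 'z::{metric_space, second_countable_topology} measure"
  assumes compact: "compact (UNIV :: 'z set)"
    and prob: "\<And>n. prob_space (\<mu> n)" and sets [measurable_cong, simp]: "\<And>n. sets (\<mu> n) = sets borel"
  obtains \<rho> r where "strict_mono r" "prob_space \<rho>" "sets \<rho> = sets borel"
    "\<And>f :: 'z \<Rightarrow> real. continuous_on UNIV f \<Longrightarrow>
       (\<lambda>n. integral\<^sup>L (\<mu> (r n)) f) \<longlonglongrightarrow> integral\<^sup>L \<rho> f"
proof -
  interpret \<mu>: prob_space "\<mu> n" for n by (rule prob)
  have space [simp]: "space (\<mu> n) = UNIV" for n using sets_eq_imp_space_eq[OF sets] by simp
  have "\<exists>c :: 'z \<Rightarrow> real. \<exists>d :: real \<Rightarrow> 'z. c \<in> borel_measurable borel \<and> d \<in> borel_measurable borel \<and>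
      finite (range c) \<and> (\<forall>z. dist (d (c z)) z < (1/2)^m)" for m :: nat
    by (rule finite_borel_coding[OF compact, of "(1/2)^m"]) auto
  then obtain c :: "nat \<Rightarrow> 'z \<Rightarrow> real" and d :: "nat \<Rightarrow> real \<Rightarrow> 'z"
    where c [measurable]: "\<And>m. c m \<in> borel_measurable borel"
    and d [measurable]: "\<And>m. d m \<in> borel_measurable borel"
    and fin: "\<And>m. finite (range (c m))" and dc: "\<And>m z. dist (d m (c m z)) z < (1/2)^m"
    by metis
  \<comment> \<open>the event that the code entries in \<open>J\<close> lie in \<open>B\<close>; it is a finite union of fibres of the first \<open>k\<close> entries as soon as \<open>J \<subseteq> {..<k}\<close>\<close>
  define S where "S J B = {z. restrict (\<lambda>j. c j z) J \<in> B}" for J :: "nat set" and B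
  define fib where "fib k y = {z. \<forall>j<k. c j z = c j y}" for k :: nat and y
  have fib_sets [measurable]: "fib k y \<in> sets borel" for k y
  proof -
    have "Measurable.pred borel (\<lambda>z. \<forall>j<k. c j z = c j y)" by measurable
    then show ?thesis by (simp add: fib_def pred_def)
  qed
  have fin_fib: "finite (range (fib k))" for k
  proof -
    have "range (fib k) \<subseteq> (\<lambda>w. {z. \<forall>j<k. c j z = w j}) ` (PiE {..<k} (\<lambda>j. range (c j)))"
    proof
      fix e assume "e \<in> range (fib k)"
      then obtain y where "e = fib k y" by blast
      have "restrict (\<lambda>j. c j y) {..<k} \<in> PiE {..<k} (\<lambda>j. range (c j))" by auto
      moreover have "e = {z. \<forall>j<k. c j z = restrict (\<lambda>j. c j y) {..<k} j}"
        using \<open>e = fib k y\<close> by (auto simp: fib_def)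
      ultimately show "e \<in> (\<lambda>w. {z. \<forall>j<k. c j z = w j}) ` (PiE {..<k} (\<lambda>j. range (c j)))" by blast
    qed
    then show ?thesis
      by (rule finite_subset) (intro finite_imageI finite_PiE fin finite_lessThan)
  qed
  have "countable (\<Union>k. range (fib k))"
    by (rule countable_UN) (simp_all add: countable_finite[OF fin_fib])
  then obtain r where r: "strict_mono r"
    and "\<And>e. e \<in> (\<Union>k. range (fib k)) \<Longrightarrow> convergent (\<lambda>n. measure (\<mu> (r n)) e)"
    by (rule countable_convergent_subsequence[of _ "\<lambda>n e. measure (\<mu> n) e"]) auto
  then have conv_fib: "convergent (\<lambda>n. measure (\<mu> (r n)) (fib k y))" for k y by blast

  have conv_S: "S J B \<in> sets borel \<and> convergent (\<lambda>n. measure (\<mu> (r n)) (S J B))"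
    if J: "finite J" for J B
  proof -
    obtain k where k: "J \<subseteq> {..<k}" using finite_nat_bounded[OF J] by blast
    define D where "D = {e \<in> range (fib k). e \<subseteq> S J B}"
    have D: "finite D" "\<And>e. e \<in> D \<Longrightarrow> e \<in> sets borel" "disjoint_family_on (\<lambda>e. e) D"
      using fin_fib[of k] by (auto simp: D_def disjoint_family_on_def fib_def)
    have eq: "S J B = (\<Union>e\<in>D. e)"
    proof -
      have "fib k z \<subseteq> S J B" if "z \<in> S J B" for z
      proof
        fix z' assume "z' \<in> fib k z"
        then have "restrict (\<lambda>j. c j z') J = restrict (\<lambda>j. c j z) J"
          using k by (auto simp: fib_def intro!: restrict_ext)
        then show "z' \<in> S J B" using that by (simp add: S_def)
      qed
      moreover have "z \<in> fib k z" for z by (simp add: fib_def)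
      ultimately show ?thesis by (fastforce simp: D_def)
    qed
    have "measure (\<mu> n) (S J B) = (\<Sum>e\<in>D. measure (\<mu> n) e)" for n
      unfolding eq using D by (intro \<mu>.finite_measure_finite_Union) auto
    moreover have "convergent (\<lambda>n. \<Sum>e\<in>D. measure (\<mu> (r n)) e)"
      using conv_fib by (intro convergent_sum) (auto simp: D_def)
    moreover have "S J B \<in> sets borel"
      unfolding eq using D by (intro sets.finite_UN) auto
    ultimately show ?thesis by simp
  qed
  define L where "L J B = lim (\<lambda>n. measure (\<mu> (r n)) (S J B))" for J B
  have lim_L: "(\<lambda>n. measure (\<mu> (r n)) (S J B)) \<longlonglongrightarrow> L J B" if "finite J" for J B
    using conv_S[OF that] convergent_LIMSEQ_iff unfolding L_def by blast
  have L_nonneg: "0 \<le> L J B" if "finite J" for J B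
    by (rule LIMSEQ_le_const[OF lim_L[OF that]]) auto

  define W where "W J = range (\<lambda>z. restrict (\<lambda>j. c j z) J)" for J :: "nat set"
  have fin_W: "finite (W J)" if "finite J" for J
  proof (rule finite_subset)
    show "W J \<subseteq> PiE J (\<lambda>j. range (c j))" by (auto simp: W_def)
    show "finite (PiE J (\<lambda>j. range (c j)))" using that fin by (intro finite_PiE)
  qed
  have L_sum: "L J B = (\<Sum>w\<in>B \<inter> W J. L J {w})" if J: "finite J" for J B
  proof -
    have "measure (\<mu> n) (S J B) = (\<Sum>w\<in>B \<inter> W J. measure (\<mu> n) (S J {w}))" for n
    proof -
      have eq: "S J B = (\<Union>w\<in>B \<inter> W J. S J {w})" by (auto simp: S_def W_def)
      have "disjoint_family_on (\<lambda>w. S J {w}) (B \<inter> W J)" by (auto simp: disjoint_family_on_def S_def)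
      then show ?thesis
        unfolding eq using fin_W[OF J] conv_S[OF J] by (intro \<mu>.finite_measure_finite_Union) auto
    qed
    then have "(\<lambda>n. measure (\<mu> (r n)) (S J B)) \<longlonglongrightarrow> (\<Sum>w\<in>B \<inter> W J. L J {w})"
      using J by (auto intro!: tendsto_sum lim_L)
    then show ?thesis using lim_L[OF J] LIMSEQ_unique by blast
  qed
  \<comment> \<open>the limit law of the entries in \<open>J\<close>, carried by the finite set \<open>W J\<close> of codes\<close>
  define P where "P J = distr (point_measure (W J) (\<lambda>w. ennreal (L J {w}))) (PiM J (\<lambda>_. borel)) (\<lambda>w. w)" for J
  have meas_P: "(\<lambda>w. w) \<in> measurable (point_measure (W J) (\<lambda>w. ennreal (L J {w}))) (PiM J (\<lambda>_. borel))" for J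
    by (auto simp: W_def space_PiM measurable_def space_point_measure sets_point_measure)
  have emeasure_P: "emeasure (P J) B = ennreal (L J B)"
    if J: "finite J" and B: "B \<in> sets (PiM J (\<lambda>_. borel))" for J B
  proof -
    have "emeasure (P J) B = emeasure (point_measure (W J) (\<lambda>w. ennreal (L J {w}))) (B \<inter> W J)"
      unfolding P_def by (subst emeasure_distr[OF meas_P B]) (simp add: space_point_measure)
    also have "\<dots> = (\<Sum>w\<in>B \<inter> W J. ennreal (L J {w}))"
      using fin_W[OF J] by (intro emeasure_point_measure_finite) auto
    also have "\<dots> = ennreal (L J B)"
      using L_nonneg[OF J] by (subst L_sum[OF J]) (simp add: sum_ennreal)
    finally show ?thesis .
  qed
  have sets_P: "sets (P J) = sets (PiM J (\<lambda>_. borel))" for J by (simp add: P_def)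
  have space_P: "space (P J) = PiE J (\<lambda>_. UNIV)" for J by (simp add: P_def space_PiM)
  interpret P: polish_projective UNIV P
  proof (intro polish_projective.intro projective_family.intro)
    fix J H :: "nat set" assume JH: "J \<subseteq> H" "finite H"
    then have J: "finite J" by (rule finite_subset)
    have m: "(\<lambda>f. restrict f J) \<in> measurable (P H) (PiM J (\<lambda>_. borel))"
      unfolding measurable_cong_sets[OF sets_P refl] using JH(1) by (rule measurable_restrict_subset)
    show "P J = distr (P H) (PiM J (\<lambda>_. borel)) (\<lambda>f. restrict f J)"
    proof (rule measure_eqI)
      fix B assume "B \<in> sets (P J)"
      then have B: "B \<in> sets (PiM J (\<lambda>_. borel))" by (simp add: sets_P)
      let ?B = "(\<lambda>f. restrict f J) -` B \<inter> space (P H)"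
      have "?B \<in> sets (P H)" by (rule measurable_sets[OF m B])
      moreover have "S H ?B = S J B"
        using JH(1) by (auto simp: S_def space_P restrict_restrict Int_absorb1)
      ultimately show "emeasure (P J) B = emeasure (distr (P H) (PiM J (\<lambda>_. borel)) (\<lambda>f. restrict f J)) B"
        using JH(2) J B by (simp add: emeasure_distr[OF m] emeasure_P sets_P L_def)
    qed (simp add: sets_P)
  next
    fix J :: "nat set" assume J: "finite J"
    have "S J (space (P J)) = UNIV" by (auto simp: S_def space_P)
    then have "L J (space (P J)) = 1"
      using \<mu>.prob_space by (simp add: L_def)
    then show "prob_space (P J)"
      using emeasure_P[OF J, of "space (P J)"] sets_P[of J] sets.top[of "P J"] by (auto intro!: prob_spaceI)
  qed
  define Q where "Q = P.lim"
  have sets_Q [measurable_cong, simp]: "sets Q = sets (PiM UNIV (\<lambda>_. borel))" by (simp add: Q_def)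
  have space_Q [simp]: "space Q = UNIV" by (simp add: Q_def space_PiM)
  interpret Q: prob_space Q unfolding Q_def by (rule P.P.prob_space_axioms)
  have lim_Q: "(\<lambda>n. measure (\<mu> (r n)) {z. R (restrict (\<lambda>j. c j z) J)}) \<longlonglongrightarrow> measure Q {w. R (restrict w J)}"
    if J: "finite J" and R: "Measurable.pred (PiM J (\<lambda>_. borel)) R" for J and R :: "(nat \<Rightarrow> real) \<Rightarrow> bool"
  proof -
    let ?B = "{x \<in> space (PiM J (\<lambda>_. borel)). R x}"
    have B: "?B \<in> sets (PiM J (\<lambda>_. borel))" using R by (simp add: pred_def)
    have "prod_emb UNIV (\<lambda>_. borel) J ?B = {w. R (restrict w J)}"
      by (auto simp: prod_emb_def space_PiM)
    then have "measure Q {w. R (restrict w J)} = measure (P J) ?B"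
      using P.measure_lim_emb[OF _ J B] by (simp add: Q_def)
    also have "\<dots> = L J ?B"
      using emeasure_P[OF J B] L_nonneg[OF J] by (simp add: measure_def)
    finally have "measure Q {w. R (restrict w J)} = L J ?B" .
    moreover have "S J ?B = {z. R (restrict (\<lambda>j. c j z) J)}" by (auto simp: S_def space_PiM)
    ultimately show ?thesis using lim_L[OF J, of ?B] by simp
  qed

  have AE_Q: "AE w in Q. \<not> R w"
    if R: "Measurable.pred (PiM UNIV (\<lambda>_. borel)) R" and 0: "measure Q {w. R w} = 0"
    for R :: "(nat \<Rightarrow> real) \<Rightarrow> bool"
  proof (rule AE_I[of _ _ "{w. R w}"])
    show "{w. R w} \<in> sets Q" using R by (simp add: pred_def space_PiM)
    show "emeasure Q {w. R w} = 0" using 0 by (simp add: Q.emeasure_eq_measure)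
  qed simp
  \<comment> \<open>code sequences whose decodings converge geometrically, as the decodings of genuine codes do\<close>
  define good :: "(nat \<Rightarrow> real) \<Rightarrow> bool" where "good w \<longleftrightarrow> (\<forall>m. dist (d m (w m)) (d (Suc m) (w (Suc m))) \<le> 2 * (1/2)^m)" for w
  have [measurable]: "Measurable.pred (PiM UNIV (\<lambda>_. borel)) good" unfolding good_def by measurable
  have "AE w in Q. dist (d m (w m)) (d (Suc m) (w (Suc m))) \<le> 2 * (1/2)^m" for m
  proof -
    let ?R = "\<lambda>w::nat \<Rightarrow> real. \<not> dist (d m (w m)) (d (Suc m) (w (Suc m))) \<le> 2 * (1/2)^m"
    have "\<not> ?R (restrict (\<lambda>j. c j z) {m, Suc m})" for z
    proof -
      have "dist (d m (c m z)) (d (Suc m) (c (Suc m) z)) \<le> dist (d m (c m z)) z + dist (d (Suc m) (c (Suc m) z)) z" by (rule dist_triangle2)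
      also have "\<dots> \<le> (1/2)^m + (1/2)^(Suc m)" by (intro add_mono less_imp_le dc)
      also have "\<dots> \<le> 2 * (1/2)^m" by simp
      finally show ?thesis by simp
    qed
    then have "(\<lambda>n. 0) \<longlonglongrightarrow> measure Q {w. ?R (restrict w {m, Suc m})}"
      using lim_Q[of "{m, Suc m}" ?R] by simp
    then have "measure Q {w. ?R w} = 0" by (simp add: LIMSEQ_const_iff)
    then show ?thesis using AE_Q[of ?R] by simp
  qed
  then have AE_good: "AE w in Q. good w" by (simp add: good_def AE_all_countable)
  define u where "u m w = (if good w then d m (w m) else undefined)" for m w
  have conv_u: "convergent (\<lambda>m. u m w)" for w
  proof (cases "good w")
    case True
    have "Cauchy (\<lambda>m. d m (w m))"
      unfolding Cauchy_altdef2
    proof (intro allI impI)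
      fix e :: real assume "e > 0"
      then obtain N where N: "(1/2)^N < e/4"
        using real_arch_pow_inv[of "e/4" "1/2"] by auto
      have "dist (d n (w n)) (d N (w N)) < e" if "N \<le> n" for n
      proof -
        have "dist (d N (w N)) (d (N + (n - N)) (w (N + (n - N)))) \<le> 4 * (1/2)^N"
          using True by (intro dist_le_of_geometric_steps[of "\<lambda>m. d m (w m)"]) (simp add: good_def)
        then show ?thesis using N that by (simp add: dist_commute)
      qed
      then show "\<exists>N. \<forall>n\<ge>N. dist (d n (w n)) (d N (w N)) < e" by blast
    qed
    then have "convergent (\<lambda>m. d m (w m))"
      using compact_imp_complete[OF compact] by (auto simp: complete_def convergent_def)
    then show ?thesis using True by (simp add: u_def[abs_def])
  qed (simp add: u_def[abs_def] convergent_const)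
  define \<pi> where "\<pi> w = lim (\<lambda>m. u m w)" for w
  have lim_\<pi>: "(\<lambda>m. u m w) \<longlonglongrightarrow> \<pi> w" for w
    unfolding \<pi>_def using conv_u convergent_LIMSEQ_iff by blast
  have [measurable]: "\<pi> \<in> borel_measurable (PiM UNIV (\<lambda>_. borel))"
    by (rule borel_measurable_LIMSEQ_metric[of u, OF _ lim_\<pi>]) (simp add: u_def[abs_def])
  have dist_\<pi>: "dist (d m (w m)) (\<pi> w) \<le> 4 * (1/2)^m" if "good w" for w m
  proof -
    have "(\<lambda>k. dist (d m (w m)) (d (m + k) (w (m + k)))) \<longlonglongrightarrow> dist (d m (w m)) (\<pi> w)"
      using LIMSEQ_ignore_initial_segment[OF lim_\<pi>[of w], of m] that
      by (intro tendsto_intros) (simp add: u_def add.commute)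
    moreover have "dist (d m (w m)) (d (m + k) (w (m + k))) \<le> 4 * (1/2)^m" for k
      using dist_le_of_geometric_steps[of "\<lambda>m. d m (w m)" m k] that by (simp add: good_def)
    ultimately show ?thesis by (intro LIMSEQ_le_const2[of _ "dist (d m (w m)) (\<pi> w)"]) auto
  qed
  define \<rho> where "\<rho> = distr Q borel \<pi>"
  have "(\<lambda>n. integral\<^sup>L (\<mu> (r n)) f) \<longlonglongrightarrow> integral\<^sup>L \<rho> f" if f: "continuous_on UNIV f" for f :: "'z \<Rightarrow> real"
  proof (rule LIMSEQ_I)
    fix e :: real assume "e > 0"
    have f_meas [measurable]: "f \<in> borel_measurable borel"
      using f by (rule borel_measurable_continuous_onI)
    obtain B where B: "\<And>z. \<bar>f z\<bar> \<le> B" using continuous_on_compact_bounded[OF compact f] by blast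
    have "uniformly_continuous_on UNIV f"
      using f compact by (rule compact_uniformly_continuous)
    then obtain t where t: "t > 0" "\<And>x y. dist x y < t \<Longrightarrow> dist (f x) (f y) < e/4"
      using \<open>e > 0\<close> by (elim uniformly_continuous_onE[of _ _ "e/4"]) (auto simp: dist_commute)
    obtain m where "(1/2)^m < t/4"
      using real_arch_pow_inv[of "t/4" "1/2"] t(1) by auto
    then have m: "4 * (1/2)^m < t" by simp
    have int_\<mu>: "integrable (\<mu> n) f" "integrable (\<mu> n) (\<lambda>z. f (d m (c m z)))" for n
      by (rule \<mu>.integrable_const_bound[of _ B]; use B in simp)+
    have int_Q: "integrable Q (\<lambda>w. f (\<pi> w))" "integrable Q (\<lambda>w. f (d m (w m)))"
      by (rule Q.integrable_const_bound[of _ B]; use B in simp)+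
    have near_\<mu>: "\<bar>integral\<^sup>L (\<mu> n) f - integral\<^sup>L (\<mu> n) (\<lambda>z. f (d m (c m z)))\<bar> \<le> e/4" for n
    proof -
      have "dist (d m (c m z)) z < t" for z
      proof -
        have "(0::real) \<le> (1/2)^m" by simp
        then show ?thesis using dc[of m z] m by linarith
      qed
      then have "\<bar>f z - f (d m (c m z))\<bar> \<le> e/4" for z
        using t(2)[of "d m (c m z)" z] by (simp add: dist_real_def abs_minus_commute)
      then show ?thesis using int_\<mu>[of n] by (intro \<mu>.integral_close) auto
    qed
    have near_Q: "\<bar>integral\<^sup>L \<rho> f - integral\<^sup>L Q (\<lambda>w. f (d m (w m)))\<bar> \<le> e/4"
    proof -
      have "AE w in Q. \<bar>f (\<pi> w) - f (d m (w m))\<bar> \<le> e/4"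
        using AE_good
      proof eventually_elim
        fix w assume "good w"
        then have "dist (d m (w m)) (\<pi> w) < t" using dist_\<pi>[of w m] m by simp
        then show "\<bar>f (\<pi> w) - f (d m (w m))\<bar> \<le> e/4" using t(2)[of "d m (w m)" "\<pi> w"] by (simp add: dist_real_def abs_minus_commute)
      qed
      then have "\<bar>integral\<^sup>L Q (\<lambda>w. f (\<pi> w)) - integral\<^sup>L Q (\<lambda>w. f (d m (w m)))\<bar> \<le> e/4"
        using int_Q by (intro Q.integral_close)
      moreover have "integral\<^sup>L \<rho> f = integral\<^sup>L Q (\<lambda>w. f (\<pi> w))"
        unfolding \<rho>_def by (rule integral_distr) measurable
      ultimately show ?thesis by simp
    qed
    let ?R = "range (c m)"
    have [measurable]: "?R \<in> sets borel" using fin[of m] by (intro borel_closed finite_imp_closed)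
    have lim_eq: "(\<lambda>n. measure (\<mu> (r n)) {z. c m z = v}) \<longlonglongrightarrow> measure Q {w. w m = v}" for v
      using lim_Q[of "{m}" "\<lambda>w. w m = v"] by simp
    have sum_\<mu>: "integral\<^sup>L (\<mu> n) (\<lambda>z. f (d m (c m z))) = (\<Sum>v\<in>?R. f (d m v) * measure (\<mu> n) {z. c m z = v})" for n
    proof -
      have "Measurable.pred borel (\<lambda>z. c m z = v)" for v by measurable
      then show ?thesis
        using \<mu>.integral_AE_finite_range[of ?R "c m" n "\<lambda>v. f (d m v)"] fin[of m] by (simp add: pred_def)
    qed
    have "(\<lambda>n. measure (\<mu> (r n)) {z. c m z \<notin> ?R}) \<longlonglongrightarrow> measure Q {w. w m \<notin> ?R}"
      using lim_Q[of "{m}" "\<lambda>w. w m \<notin> ?R"] by simp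
    then have "measure Q {w. w m \<notin> ?R} = 0" by (simp add: LIMSEQ_const_iff)
    then have AE_R: "AE w in Q. w m \<in> ?R"
      using AE_Q[of "\<lambda>w. w m \<notin> ?R"] by simp
    have sum_Q: "integral\<^sup>L Q (\<lambda>w. f (d m (w m))) = (\<Sum>v\<in>?R. f (d m v) * measure Q {w. w m = v})"
    proof -
      have "Measurable.pred (PiM UNIV (\<lambda>_. borel)) (\<lambda>w :: nat \<Rightarrow> real. w m = v)" for v by measurable
      then show ?thesis
        using Q.integral_AE_finite_range[of ?R "\<lambda>w. w m" "\<lambda>v. f (d m v)"] fin[of m] AE_R by (simp add: pred_def space_PiM)
    qed
    have "(\<lambda>n. integral\<^sup>L (\<mu> (r n)) (\<lambda>z. f (d m (c m z)))) \<longlonglongrightarrow> integral\<^sup>L Q (\<lambda>w. f (d m (w m)))"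
      unfolding sum_\<mu> sum_Q by (intro tendsto_intros lim_eq)
    then obtain N where "\<forall>n\<ge>N. norm (integral\<^sup>L (\<mu> (r n)) (\<lambda>z. f (d m (c m z))) - integral\<^sup>L Q (\<lambda>w. f (d m (w m)))) < e/4"
      using LIMSEQ_D[of _ _ "e/4"] \<open>e > 0\<close> by force
    then have N: "\<bar>integral\<^sup>L (\<mu> (r n)) (\<lambda>z. f (d m (c m z))) - integral\<^sup>L Q (\<lambda>w. f (d m (w m)))\<bar> < e/4" if "n \<ge> N" for n
      using that by simp
    have "\<bar>integral\<^sup>L (\<mu> (r n)) f - integral\<^sup>L \<rho> f\<bar> < e" if "n \<ge> N" for n
      using N[OF that] near_Q near_\<mu>[of "r n"] \<open>e > 0\<close> by linarith
    then have "\<forall>n\<ge>N. norm (integral\<^sup>L (\<mu> (r n)) f - integral\<^sup>L \<rho> f) < e" by simp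
    then show "\<exists>N. \<forall>n\<ge>N. norm (integral\<^sup>L (\<mu> (r n)) f - integral\<^sup>L \<rho> f) < e" by blast
  qed
  moreover have "prob_space \<rho>" unfolding \<rho>_def by (rule Q.prob_space_distr) measurable
  moreover have "sets \<rho> = sets borel" by (simp add: \<rho>_def)
  ultimately show ?thesis using that r by blast
qed

section \<open>Determining families and invariant measures\<close>

text \<open>
  The whole space is treated separately because \<open>infdist z {} = 0\<close>.
\<close>
lemma open_indicator_limit:
  fixes U :: "'z::metric_space set"
  assumes "open U"
  obtains f :: "nat \<Rightarrow> 'z \<Rightarrow> real" where "\<And>n. continuous_on UNIV (f n)" "\<And>n z. 0 \<le> f n z"
    "\<And>n z. f n z \<le> indicator U z" "\<And>z. (\<lambda>n. f n z) \<longlonglongrightarrow> indicator U z"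
proof (cases "U = UNIV")
  case True
  then show ?thesis using that[of "\<lambda>_ _. 1"] by simp
next
  case False
  define f where "f n z = min 1 (real n * infdist z (- U))" for n and z :: 'z
  have out: "f n z = 0" if "z \<notin> U" for n z using that by (simp add: f_def)
  have "(\<lambda>n. f n z) \<longlonglongrightarrow> indicator U z" for z
  proof (cases "z \<in> U")
    case True
    have "infdist z (- U) \<noteq> 0"
      using in_closed_iff_infdist_zero[of "- U" z] assms False True by (auto simp: closed_Compl)
    then have pos: "infdist z (- U) > 0" using infdist_nonneg[of z "- U"] by linarith
    then obtain N where "1 < real N * infdist z (- U)" using reals_Archimedean3 by blast
    then have "\<forall>n\<ge>N. f n z = 1"
      using pos by (auto simp: f_def min_def) (smt (verit) mult_right_mono of_nat_mono)
    then have "eventually (\<lambda>n. f n z = 1) sequentially"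
      unfolding eventually_sequentially by blast
    then show ?thesis using True by (simp add: tendsto_eventually)
  qed (simp add: out)
  moreover have "continuous_on UNIV (f n)" for n
    unfolding f_def by (intro continuous_intros)
  moreover have "0 \<le> f n z" for n z by (simp add: f_def infdist_nonneg)
  moreover have "f n z \<le> indicator U z" for n z
    using out[of z n] by (cases "z \<in> U") (auto simp: f_def)
  ultimately show ?thesis using that by blast
qed

lemma open_indicator_integral_limit:
  fixes f :: "nat \<Rightarrow> 'z::metric_space \<Rightarrow> real"
  assumes "prob_space \<rho>" and s: "sets \<rho> = sets borel" and "open U"
    and f: "\<And>n. continuous_on UNIV (f n)" "\<And>n z. 0 \<le> f n z" "\<And>n z. f n z \<le> indicator U z"
      "\<And>z. (\<lambda>n. f n z) \<longlonglongrightarrow> indicator U z"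
  shows "(\<lambda>n. integral\<^sup>L \<rho> (f n)) \<longlonglongrightarrow> measure \<rho> U"
proof -
  interpret prob_space \<rho> by fact
  have U: "U \<in> sets \<rho>" using s \<open>open U\<close> by simp
  have m: "f n \<in> borel_measurable \<rho>" for n
    using borel_measurable_continuous_onI[OF f(1)] by (simp add: measurable_cong_sets[OF s refl])
  have "f n z \<le> 1" for n z by (rule order_trans[OF f(3) indicator_le_1])
  then have "(\<lambda>n. integral\<^sup>L \<rho> (f n)) \<longlonglongrightarrow> integral\<^sup>L \<rho> (indicator U)"
    using f U m by (intro integral_dominated_convergence[where w = "\<lambda>_. 1"]) auto
  then show ?thesis using U sets.sets_into_space by (simp add: Int_absorb2)
qed

text \<open>
  The functions approximate the indicators of a countable basis that is closed under finite
  intersections, so their integrals determine the measure on an intersection-stable generator.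
  Countability is what makes a strictly convex functional of the form \<open>\<Sum>k. (1/2)^k * (\<integral> \<phi> k)\<^sup>2\<close>
  available.
\<close>
lemma countable_measure_determining_family:
  obtains \<phi> :: "nat \<Rightarrow> 'z::{metric_space, second_countable_topology} \<Rightarrow> real"
  where "\<And>k. continuous_on UNIV (\<phi> k)" "\<And>k z. 0 \<le> \<phi> k z \<and> \<phi> k z \<le> 1"
    "\<And>\<rho> \<sigma>. prob_space \<rho> \<Longrightarrow> prob_space \<sigma> \<Longrightarrow> sets \<rho> = sets borel \<Longrightarrow> sets \<sigma> = sets borel \<Longrightarrow>
       (\<And>k. integral\<^sup>L \<rho> (\<phi> k) = integral\<^sup>L \<sigma> (\<phi> k)) \<Longrightarrow> \<rho> = \<sigma>"
proof -
  obtain B :: "'z set set" where B: "countable B" "topological_basis B"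
    using ex_countable_basis by blast
  define V where "V = Inter ` {S. finite S \<and> S \<subseteq> B}"
  have "{} \<in> {S. finite S \<and> S \<subseteq> B}" by simp
  then have V: "countable V" "V \<noteq> {}" "UNIV \<in> V"
    using countable_Collect_finite_subset[OF B(1)] by (auto simp: V_def)
  have B_V: "B \<subseteq> V"
  proof
    fix U assume "U \<in> B"
    then have "U = \<Inter>{U}" "{U} \<in> {S. finite S \<and> S \<subseteq> B}" by auto
    then show "U \<in> V" unfolding V_def by blast
  qed
  have open_V: "open U" if "U \<in> V" for U
    using that topological_basis_open[OF B(2)] by (auto simp: V_def)
  have V_Int: "Int_stable V"
  proof (rule Int_stableI)
    fix a b assume "a \<in> V" "b \<in> V"
    then obtain S T where "a = \<Inter>S" "b = \<Inter>T" "finite (S \<union> T)" "S \<union> T \<subseteq> B" by (auto simp: V_def)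
    then have "a \<inter> b = \<Inter>(S \<union> T)" "S \<union> T \<in> {S. finite S \<and> S \<subseteq> B}" by auto
    then show "a \<inter> b \<in> V" unfolding V_def by blast
  qed
  have sets_V: "sets (borel :: 'z measure) = sigma_sets UNIV V"
  proof
    have "sets (borel :: 'z measure) = sigma_sets UNIV B"
      by (subst borel_eq_countable_basis[OF B]) (simp add: sets_measure_of)
    then show "sets (borel :: 'z measure) \<subseteq> sigma_sets UNIV V"
      using sigma_sets_mono'[OF B_V] by simp
    show "sigma_sets UNIV V \<subseteq> sets (borel :: 'z measure)"
      using sets.sigma_sets_subset[of V borel] open_V by (simp add: subset_iff)
  qed
  have "\<exists>f :: nat \<Rightarrow> 'z \<Rightarrow> real. (\<forall>n. continuous_on UNIV (f n)) \<and> (\<forall>n z. 0 \<le> f n z) \<and>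
      (\<forall>n z. f n z \<le> indicator U z) \<and> (\<forall>z. (\<lambda>n. f n z) \<longlonglongrightarrow> indicator U z)" if "U \<in> V" for U
    by (rule open_indicator_limit[OF open_V[OF that]]) blast
  then obtain f :: "'z set \<Rightarrow> nat \<Rightarrow> 'z \<Rightarrow> real" where f: "\<And>U n. U \<in> V \<Longrightarrow> continuous_on UNIV (f U n)"
    "\<And>U n z. U \<in> V \<Longrightarrow> 0 \<le> f U n z" "\<And>U n z. U \<in> V \<Longrightarrow> f U n z \<le> indicator U z"
    "\<And>U z. U \<in> V \<Longrightarrow> (\<lambda>n. f U n z) \<longlonglongrightarrow> indicator U z"
    by metis
  define \<phi> where "\<phi> k = (case prod_decode k of (i, n) \<Rightarrow> f (from_nat_into V i) n)" for k
  have in_V: "from_nat_into V i \<in> V" for i using V(2) by (rule from_nat_into)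
  have cont: "continuous_on UNIV (\<phi> k)" for k
    using f(1)[OF in_V] by (simp add: \<phi>_def split: prod.split)
  have bound: "0 \<le> \<phi> k z \<and> \<phi> k z \<le> 1" for k z
    using f(2)[OF in_V] order_trans[OF f(3)[OF in_V] indicator_le_1] by (simp add: \<phi>_def split: prod.split)
  have lim: "(\<lambda>n. integral\<^sup>L \<rho> (\<phi> (prod_encode (i, n)))) \<longlonglongrightarrow> measure \<rho> (from_nat_into V i)"
    if \<rho>: "prob_space \<rho>" "sets \<rho> = sets borel" for \<rho> i
    using open_indicator_integral_limit[OF \<rho> open_V[OF in_V] f[OF in_V]] by (simp add: \<phi>_def)
  show thesis
  proof (rule that[OF cont bound])
    fix \<rho> \<sigma> :: "'z measure"
    assume \<rho>: "prob_space \<rho>" "sets \<rho> = sets borel" and \<sigma>: "prob_space \<sigma>" "sets \<sigma> = sets borel"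
      and eq: "\<And>k. integral\<^sup>L \<rho> (\<phi> k) = integral\<^sup>L \<sigma> (\<phi> k)"
    interpret \<rho>: prob_space \<rho> by fact
    interpret \<sigma>: prob_space \<sigma> by fact
    show "\<rho> = \<sigma>"
    proof (rule measure_eqI_generator_eq[OF V_Int, of UNIV _ _ "\<lambda>_. UNIV"])
      fix X assume "X \<in> V"
      then obtain i where i: "X = from_nat_into V i" using V(1) from_nat_into_surj by metis
      show "emeasure \<rho> X = emeasure \<sigma> X"
      proof -
        have "measure \<rho> X = measure \<sigma> X"
          using LIMSEQ_unique[OF lim[OF \<rho>, of i]] lim[OF \<sigma>, of i] eq i by simp
        then show ?thesis by (simp add: \<rho>.emeasure_eq_measure \<sigma>.emeasure_eq_measure)
      qed
    qed (use V(3) sets_V \<rho>(2) \<sigma>(2) in auto)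
  qed
qed

lemma continuous_integrals_eq_imp_measure_eq:
  fixes \<rho> \<sigma> :: "'z::{metric_space, second_countable_topology} measure"
  assumes "prob_space \<rho>" "prob_space \<sigma>" "sets \<rho> = sets borel" "sets \<sigma> = sets borel"
    and "\<And>f :: 'z \<Rightarrow> real. continuous_on UNIV f \<Longrightarrow> integral\<^sup>L \<rho> f = integral\<^sup>L \<sigma> f"
  shows "\<rho> = \<sigma>"
  by (rule countable_measure_determining_family[where 'z = 'z]) (use assms in blast)

lemma invariant_probI_integral:
  fixes T :: "'g \<Rightarrow> 'z::{metric_space, second_countable_topology} \<Rightarrow> 'z"
  assumes T: "\<And>g. continuous_on UNIV (T g)" and \<rho>: "prob_space \<rho>" "sets \<rho> = sets borel"
    and eq: "\<And>g f. continuous_on UNIV f \<Longrightarrow> integral\<^sup>L \<rho> (\<lambda>z. f (T g z)) = (integral\<^sup>L \<rho> f :: real)"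
  shows "invariant_prob borel T \<rho>"
  unfolding invariant_prob_def
proof (intro conjI allI)
  fix g
  show m: "T g \<in> measurable borel borel" using T by (rule borel_measurable_continuous_onI)
  then have m': "T g \<in> measurable \<rho> borel" using \<rho>(2) by (simp cong: measurable_cong_sets)
  show "distr \<rho> borel (T g) = \<rho>"
  proof (rule continuous_integrals_eq_imp_measure_eq)
    show "prob_space (distr \<rho> borel (T g))" using \<rho>(1) m' by (rule prob_space.prob_space_distr)
    show "integral\<^sup>L (distr \<rho> borel (T g)) f = integral\<^sup>L \<rho> f" if "continuous_on UNIV f" for f :: "'z \<Rightarrow> real"
      using that eq by (simp add: integral_distr[OF m'] borel_measurable_continuous_onI)
  qed (use \<rho> in auto)
qed (use \<rho> in auto)

lemma invariant_prob_integral: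
  fixes f :: "'z::topological_space \<Rightarrow> real"
  assumes "invariant_prob borel T \<rho>" "f \<in> borel_measurable borel"
  shows "integral\<^sup>L \<rho> (\<lambda>z. f (T g z)) = integral\<^sup>L \<rho> f"
proof -
  have "T g \<in> measurable \<rho> borel" "distr \<rho> borel (T g) = \<rho>"
    using assms(1) by (auto simp: invariant_prob_def cong: measurable_cong_sets)
  then show ?thesis using integral_distr[of "T g" \<rho> borel f] assms(2) by simp
qed

lemma (in prob_space) integral_uniform_measure:
  fixes f :: "'a \<Rightarrow> real"
  assumes A: "A \<in> events" "prob A > 0" and f: "f \<in> borel_measurable M"
  shows "integral\<^sup>L (uniform_measure M A) f = expectation (\<lambda>x. indicator A x * f x) / prob A"
proof -
  have "uniform_measure M A = density M (\<lambda>x. ennreal (indicator A x / prob A))"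
    unfolding uniform_measure_def
    using A(2) by (intro arg_cong2[where f = density] refl ext)
      (simp add: emeasure_eq_measure indicator_def ennreal_1[symmetric] divide_ennreal del: ennreal_1)
  then show ?thesis
    using A f by (simp add: integral_density)
qed

lemma invariant_prob_uniform_measure:
  assumes \<rho>: "invariant_prob borel T \<rho>"
    and A: "A \<in> sets borel" "\<And>g. T g -` A = A" "measure \<rho> A > 0"
  shows "invariant_prob borel T (uniform_measure \<rho> A)"
proof -
  interpret prob_space \<rho> using \<rho> by (simp add: invariant_prob_def)
  have s: "sets \<rho> = sets borel" using \<rho> by (simp add: invariant_prob_def)
  have em: "emeasure \<rho> A \<noteq> 0" using A(3) by (simp add: emeasure_eq_measure)
  show ?thesis
    unfolding invariant_prob_def
  proof (intro conjI allI)
    show "sets (uniform_measure \<rho> A) = sets borel" using s by simp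
    show "prob_space (uniform_measure \<rho> A)" using em by (intro prob_space_uniform_measure) auto
    fix g
    show m: "T g \<in> measurable borel borel" using \<rho> by (simp add: invariant_prob_def)
    have mU: "T g \<in> measurable (uniform_measure \<rho> A) borel" using m s by (simp cong: measurable_cong_sets)
    have m\<rho>: "T g \<in> measurable \<rho> borel" using m s by (simp cong: measurable_cong_sets)
    have d: "distr \<rho> borel (T g) = \<rho>" using \<rho> by (simp add: invariant_prob_def)
    have sp: "space \<rho> = UNIV" using sets_eq_imp_space_eq[OF s] by simp
    show "distr (uniform_measure \<rho> A) borel (T g) = uniform_measure \<rho> A"
    proof (rule measure_eqI)
      fix B assume "B \<in> sets (distr (uniform_measure \<rho> A) borel (T g))"
      then have B: "B \<in> sets borel" by simp
      have TB: "T g -` B \<in> sets borel" using measurable_sets[OF m B] by simp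
      have "emeasure \<rho> (A \<inter> T g -` B) = emeasure \<rho> (T g -` (A \<inter> B))"
        using A(2)[of g] by (simp add: vimage_Int)
      also have "\<dots> = emeasure (distr \<rho> borel (T g)) (A \<inter> B)"
        using A(1) B sp by (simp add: emeasure_distr[OF m\<rho>])
      also have "\<dots> = emeasure \<rho> (A \<inter> B)" using d by simp
      finally have eq: "emeasure \<rho> (A \<inter> T g -` B) = emeasure \<rho> (A \<inter> B)" .
      have "emeasure (distr (uniform_measure \<rho> A) borel (T g)) B = emeasure (uniform_measure \<rho> A) (T g -` B)"
        by (simp add: emeasure_distr[OF mU B] sp)
      also have "\<dots> = emeasure (uniform_measure \<rho> A) B"
        using eq A(1) B TB s by simp
      finally show "emeasure (distr (uniform_measure \<rho> A) borel (T g)) B = emeasure (uniform_measure \<rho> A) B" .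
    qed (use s in simp)
  qed
qed

section \<open>Maximising measures are ergodic\<close>

lemma invariant_prob_weak_limit:
  fixes T :: "'g \<Rightarrow> 'z::{metric_space, second_countable_topology} \<Rightarrow> 'z"
  assumes T: "\<And>g. continuous_on UNIV (T g)" and inv: "\<And>n. invariant_prob borel T (\<rho>s n)"
    and \<rho>: "prob_space \<rho>" "sets \<rho> = sets borel"
    and lim: "\<And>f :: 'z \<Rightarrow> real. continuous_on UNIV f \<Longrightarrow> (\<lambda>n. integral\<^sup>L (\<rho>s n) f) \<longlonglongrightarrow> integral\<^sup>L \<rho> f"
  shows "invariant_prob borel T \<rho>"
proof (rule invariant_probI_integral[OF T \<rho>])
  fix g and f :: "'z \<Rightarrow> real" assume f: "continuous_on UNIV f"
  have "continuous_on UNIV (\<lambda>z. f (T g z))"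
    by (rule continuous_on_compose2[OF f T]) simp
  then have "(\<lambda>n. integral\<^sup>L (\<rho>s n) (\<lambda>z. f (T g z))) \<longlonglongrightarrow> integral\<^sup>L \<rho> (\<lambda>z. f (T g z))" by (rule lim)
  moreover have "integral\<^sup>L (\<rho>s n) (\<lambda>z. f (T g z)) = integral\<^sup>L (\<rho>s n) f" for n
    by (intro invariant_prob_integral inv borel_measurable_continuous_onI f)
  ultimately show "integral\<^sup>L \<rho> (\<lambda>z. f (T g z)) = integral\<^sup>L \<rho> f"
    using lim[OF f] LIMSEQ_unique by simp
qed

text \<open>
  The invariant measures are weakly sequentially compact, so a maximising sequence has a weak limit
  point, at which the supremum is attained.
\<close>
lemma invariant_prob_maximiser_exists:
  fixes T :: "'g \<Rightarrow> 'z::{metric_space, second_countable_topology} \<Rightarrow> 'z" and V :: "'z measure \<Rightarrow> real"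
  assumes compact: "compact (UNIV :: 'z set)" and T: "\<And>g. continuous_on UNIV (T g)" and ne: "invariant_prob borel T \<tau>"
    and bound: "\<And>\<rho>. invariant_prob borel T \<rho> \<Longrightarrow> V \<rho> \<le> C"
    and cont: "\<And>\<rho>s \<rho>. (\<And>n. invariant_prob borel T (\<rho>s n)) \<Longrightarrow> invariant_prob borel T \<rho> \<Longrightarrow>
      (\<And>f :: 'z \<Rightarrow> real. continuous_on UNIV f \<Longrightarrow> (\<lambda>n. integral\<^sup>L (\<rho>s n) f) \<longlonglongrightarrow> integral\<^sup>L \<rho> f) \<Longrightarrow>
      (\<lambda>n. V (\<rho>s n)) \<longlonglongrightarrow> V \<rho>"
  obtains \<rho> where "invariant_prob borel T \<rho>" "\<And>\<sigma>. invariant_prob borel T \<sigma> \<Longrightarrow> V \<sigma> \<le> V \<rho>"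
proof -
  define s where "s = Sup (V ` Collect (invariant_prob borel T))"
  have bdd: "bdd_above (V ` Collect (invariant_prob borel T))"
    using bound by (intro bdd_aboveI[of _ C]) auto
  have upper: "V \<sigma> \<le> s" if "invariant_prob borel T \<sigma>" for \<sigma>
    unfolding s_def using that bdd by (intro cSup_upper) auto
  have "\<exists>\<rho>. invariant_prob borel T \<rho> \<and> s - 1 / Suc n < V \<rho>" for n
  proof -
    have "\<exists>x\<in>V ` Collect (invariant_prob borel T). s - 1 / Suc n < x"
      using less_cSup_iff[OF _ bdd, of "s - 1 / Suc n"] ne unfolding s_def by auto
    then show ?thesis by auto
  qed
  then obtain \<rho>s where \<rho>s: "\<And>n. invariant_prob borel T (\<rho>s n)" "\<And>n. s - 1 / Suc n < V (\<rho>s n)" by metis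
  obtain \<rho> r where r: "strict_mono r" "prob_space \<rho>" "sets \<rho> = sets borel"
    "\<And>f :: 'z \<Rightarrow> real. continuous_on UNIV f \<Longrightarrow> (\<lambda>n. integral\<^sup>L (\<rho>s (r n)) f) \<longlonglongrightarrow> integral\<^sup>L \<rho> f"
    by (rule weak_limit_exists[of \<rho>s, OF compact]) (use \<rho>s(1) in \<open>auto simp: invariant_prob_def\<close>)
  have inv: "invariant_prob borel T \<rho>"
    using T \<rho>s(1) r(2,3,4) by (rule invariant_prob_weak_limit[of T "\<lambda>n. \<rho>s (r n)"])
  have "(\<lambda>n. V (\<rho>s (r n))) \<longlonglongrightarrow> V \<rho>"
    using \<rho>s(1) inv r(4) by (rule cont)
  moreover have "(\<lambda>n. V (\<rho>s n)) \<longlonglongrightarrow> s"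
  proof (rule tendsto_sandwich[of "\<lambda>n. s - 1 / Suc n" _ _ "\<lambda>_. s"])
    show "(\<lambda>n. s - 1 / Suc n) \<longlonglongrightarrow> s"
      using tendsto_diff[OF tendsto_const LIMSEQ_inverse_real_of_nat, of s] by (simp add: inverse_eq_divide)
  qed (use \<rho>s upper in \<open>auto intro!: always_eventually intro: less_imp_le\<close>)
  then have "(\<lambda>n. V (\<rho>s (r n))) \<longlonglongrightarrow> s"
    using LIMSEQ_subseq_LIMSEQ[OF _ r(1)] by (auto simp: o_def)
  ultimately have "V \<rho> = s" by (rule LIMSEQ_unique)
  then show thesis using that inv upper by simp
qed

text \<open>
  An extreme point of the set of invariant measures is ergodic: an invariant set of intermediate
  measure splits the measure into its two conditional measures.
\<close>
lemma not_ergodic_split: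
  fixes T :: "'g \<Rightarrow> 'z::topological_space \<Rightarrow> 'z"
  assumes \<rho>: "invariant_prob borel T \<rho>" and ne: "\<not> ergodic_for T \<rho>"
  obtains a \<rho>1 \<rho>2 where "0 < a" "a < 1" "\<rho>1 \<noteq> \<rho>2"
    "invariant_prob borel T \<rho>1" "invariant_prob borel T \<rho>2"
    "\<And>f :: 'z \<Rightarrow> real. integrable \<rho> f \<Longrightarrow>
       integral\<^sup>L \<rho> f = a * integral\<^sup>L \<rho>1 f + (1 - a) * integral\<^sup>L \<rho>2 f"
proof -
  interpret prob_space \<rho> using \<rho> by (simp add: invariant_prob_def)
  have s: "sets \<rho> = sets borel" using \<rho> by (simp add: invariant_prob_def)
  have sp: "space \<rho> = UNIV" using sets_eq_imp_space_eq[OF s] by simp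
  obtain A where A: "A \<in> sets \<rho>" "\<And>g. T g -` A = A" "prob A \<noteq> 0" "prob A \<noteq> 1"
    using ne by (auto simp: ergodic_for_def sp)
  have compl: "prob (- A) = 1 - prob A" using prob_compl[OF A(1)] sp by (simp add: Compl_eq_Diff_UNIV)
  have pos: "0 < prob A" "prob A < 1"
    using A(3,4) prob_le_1[of A] measure_nonneg[of \<rho> A] by linarith+
  have A': "- A \<in> sets \<rho>" using sets.compl_sets[OF A(1)] sp by (simp add: Compl_eq_Diff_UNIV)
  have inv: "invariant_prob borel T (uniform_measure \<rho> A)" "invariant_prob borel T (uniform_measure \<rho> (- A))"
    using A A' pos compl s by (auto intro!: invariant_prob_uniform_measure[OF \<rho>] simp: vimage_Compl)
  have "measure (uniform_measure \<rho> A) A \<noteq> measure (uniform_measure \<rho> (- A)) A"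
    using A(1) A' pos compl by (simp add: emeasure_eq_measure)
  then have neq: "uniform_measure \<rho> A \<noteq> uniform_measure \<rho> (- A)" by metis
  have split: "integral\<^sup>L \<rho> f = prob A * integral\<^sup>L (uniform_measure \<rho> A) f
      + (1 - prob A) * integral\<^sup>L (uniform_measure \<rho> (- A)) f" if f: "integrable \<rho> f" for f :: "'z \<Rightarrow> real"
  proof -
    have "integral\<^sup>L \<rho> f = integral\<^sup>L \<rho> (\<lambda>x. indicator A x * f x + indicator (- A) x * f x)"
      by (intro Bochner_Integration.integral_cong) (auto simp: indicator_def)
    also have "\<dots> = integral\<^sup>L \<rho> (\<lambda>x. indicator A x * f x) + integral\<^sup>L \<rho> (\<lambda>x. indicator (- A) x * f x)"
      using f A(1) A' by (intro Bochner_Integration.integral_add)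
        (auto intro: integrable_mult_indicator[where 'b = real, simplified])
    finally show ?thesis
      using integral_uniform_measure[OF A(1), of f] integral_uniform_measure[OF A', of f] pos compl f by simp
  qed
  show thesis using that[OF pos neq inv split] .
qed

text \<open>
  Bauer's maximum principle. The functional \<open>V \<rho> = \<integral> F d\<rho> + \<eta> * \<Psi> \<rho>\<close>, with \<open>\<Psi>\<close> a weighted
  sum of squares of the integrals of a determining family, is weakly continuous and strictly convex.
  It has a maximiser \<open>\<rho>\<close>, and strict convexity forbids a splitting of \<open>\<rho>\<close> into two distinct
  invariant measures, so \<open>\<rho>\<close> is ergodic. Hence every invariant measure \<open>\<tau>\<close> satisfies
  \<open>\<integral> F d\<tau> \<le> V \<rho> \<le> c + 2 * \<eta>\<close>, and \<open>\<eta>\<close> is arbitrary.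
\<close>
theorem integral_bound_from_ergodic:
  fixes T :: "'g \<Rightarrow> 'z::{metric_space, second_countable_topology} \<Rightarrow> 'z" and F :: "'z \<Rightarrow> real"
  assumes compact: "compact (UNIV :: 'z set)" and T: "\<And>g. continuous_on UNIV (T g)" and F: "continuous_on UNIV F"
    and erg: "\<And>\<rho>. invariant_prob borel T \<rho> \<Longrightarrow> ergodic_for T \<rho> \<Longrightarrow> integral\<^sup>L \<rho> F \<le> c"
    and \<tau>: "invariant_prob borel T \<tau>"
  shows "integral\<^sup>L \<tau> F \<le> c"
proof -
  obtain \<phi> :: "nat \<Rightarrow> 'z \<Rightarrow> real" where \<phi>: "\<And>k. continuous_on UNIV (\<phi> k)"
    "\<And>k z. 0 \<le> \<phi> k z \<and> \<phi> k z \<le> 1"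
    and det: "\<And>\<rho> \<sigma>. prob_space \<rho> \<Longrightarrow> prob_space \<sigma> \<Longrightarrow> sets \<rho> = sets borel \<Longrightarrow> sets \<sigma> = sets borel \<Longrightarrow>
       (\<And>k. integral\<^sup>L \<rho> (\<phi> k) = integral\<^sup>L \<sigma> (\<phi> k)) \<Longrightarrow> \<rho> = \<sigma>"
    using countable_measure_determining_family by blast
  have integrable_cont: "integrable \<rho> f" if \<rho>: "invariant_prob borel T \<rho>" and f: "continuous_on UNIV f"
    for \<rho> and f :: "'z \<Rightarrow> real"
  proof -
    interpret prob_space \<rho> using \<rho> by (simp add: invariant_prob_def)
    obtain B where "\<And>z. \<bar>f z\<bar> \<le> B" using continuous_on_compact_bounded[OF compact f] by blast
    moreover have "f \<in> borel_measurable \<rho>"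
      using \<rho> borel_measurable_continuous_onI[OF f] by (simp add: invariant_prob_def cong: measurable_cong_sets)
    ultimately show ?thesis by (intro integrable_const_bound[of _ B]) auto
  qed
  have \<phi>_int: "0 \<le> integral\<^sup>L \<rho> (\<phi> k)" "integral\<^sup>L \<rho> (\<phi> k) \<le> 1" if \<rho>: "invariant_prob borel T \<rho>" for \<rho> k
  proof -
    interpret prob_space \<rho> using \<rho> by (simp add: invariant_prob_def)
    show "0 \<le> integral\<^sup>L \<rho> (\<phi> k)" using \<phi>(2) by (intro integral_nonneg_AE) auto
    show "integral\<^sup>L \<rho> (\<phi> k) \<le> 1" using \<phi>(2) integrable_cont[OF \<rho> \<phi>(1)] by (intro integral_le_const) auto
  qed
  define \<Psi> where "\<Psi> \<rho> = (\<Sum>k. (1/2)^k * (integral\<^sup>L \<rho> (\<phi> k))\<^sup>2)" for \<rho>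
  have sum2: "summable (\<lambda>k. (1/2)^k :: real)" by simp
  have term_le: "\<bar>(1/2)^k * (integral\<^sup>L \<rho> (\<phi> k))\<^sup>2\<bar> \<le> (1/2)^k" if "invariant_prob borel T \<rho>" for \<rho> k
    using \<phi>_int[OF that, of k] by (simp add: abs_mult power_le_one mult_left_le)
  have summ: "summable (\<lambda>k. (1/2)^k * (integral\<^sup>L \<rho> (\<phi> k))\<^sup>2)" if "invariant_prob borel T \<rho>" for \<rho>
    using term_le[OF that] by (intro summable_comparison_test'[OF sum2]) simp
  have \<Psi>_nonneg: "0 \<le> \<Psi> \<rho>" if "invariant_prob borel T \<rho>" for \<rho>
    unfolding \<Psi>_def by (intro suminf_nonneg summ that) simp
  have \<Psi>_le: "\<Psi> \<rho> \<le> 2" if "invariant_prob borel T \<rho>" for \<rho>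
  proof -
    have "\<Psi> \<rho> \<le> (\<Sum>k. (1/2)^k)"
      unfolding \<Psi>_def using term_le[OF that] by (intro suminf_le summ that sum2) (simp add: abs_le_iff)
    then show ?thesis using suminf_geometric[of "1/2::real"] by simp
  qed
  obtain B where B: "\<And>z. \<bar>F z\<bar> \<le> B" using continuous_on_compact_bounded[OF compact F] by blast

  have main: "integral\<^sup>L \<tau> F \<le> c + 2 * \<eta>" if \<eta>: "\<eta> > 0" for \<eta>
  proof -
    define V where "V \<rho> = integral\<^sup>L \<rho> F + \<eta> * \<Psi> \<rho>" for \<rho>
    have "V \<rho> \<le> B + \<eta> * 2" if "invariant_prob borel T \<rho>" for \<rho>
    proof -
      interpret prob_space \<rho> using that by (simp add: invariant_prob_def)
      have "integral\<^sup>L \<rho> F \<le> B"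
        using B by (intro integral_le_const integrable_cont that F) (auto simp: abs_le_iff)
      then show ?thesis unfolding V_def using \<Psi>_le[OF that] \<eta> by (intro add_mono mult_left_mono) auto
    qed
    moreover have "(\<lambda>n. V (\<rho>s n)) \<longlonglongrightarrow> V \<rho>"
      if inv: "\<And>n. invariant_prob borel T (\<rho>s n)"
        and lim: "\<And>f :: 'z \<Rightarrow> real. continuous_on UNIV f \<Longrightarrow> (\<lambda>n. integral\<^sup>L (\<rho>s n) f) \<longlonglongrightarrow> integral\<^sup>L \<rho> f"
      for \<rho>s \<rho>
    proof -
      have "(\<lambda>n. \<Psi> (\<rho>s n)) \<longlonglongrightarrow> \<Psi> \<rho>"
        unfolding \<Psi>_def
        using term_le[OF inv]
        by (intro tannerys_theorem[where M = "\<lambda>k. (1/2)^k", THEN conjunct2, THEN conjunct2] tendsto_intros lim \<phi>)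
           (auto intro!: always_eventually simp: sum2)
      then show ?thesis unfolding V_def by (intro tendsto_intros lim F)
    qed
    ultimately obtain \<rho> where \<rho>: "invariant_prob borel T \<rho>"
      and max: "\<And>\<sigma>. invariant_prob borel T \<sigma> \<Longrightarrow> V \<sigma> \<le> V \<rho>"
      using invariant_prob_maximiser_exists[OF compact T \<tau>, of V "B + \<eta> * 2"] by blast
    have "ergodic_for T \<rho>"
    proof (rule ccontr)
      assume "\<not> ergodic_for T \<rho>"
      then obtain a \<rho>1 \<rho>2 where a: "0 < a" "a < 1" and neq: "\<rho>1 \<noteq> \<rho>2"
        and inv: "invariant_prob borel T \<rho>1" "invariant_prob borel T \<rho>2"
        and split: "\<And>f :: 'z \<Rightarrow> real. integrable \<rho> f \<Longrightarrow>
          integral\<^sup>L \<rho> f = a * integral\<^sup>L \<rho>1 f + (1 - a) * integral\<^sup>L \<rho>2 f"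
        using not_ergodic_split[OF \<rho>] by metis
      let ?u = "\<lambda>k. integral\<^sup>L \<rho>1 (\<phi> k)" and ?v = "\<lambda>k. integral\<^sup>L \<rho>2 (\<phi> k)"
      obtain k where k: "?u k \<noteq> ?v k"
        using det[of \<rho>1 \<rho>2] inv neq by (auto simp: invariant_prob_def)
      \<comment> \<open>strict convexity of the square, term by term\<close>
      have gap: "a * ((1/2)^k * (?u k)\<^sup>2) + (1 - a) * ((1/2)^k * (?v k)\<^sup>2) - (1/2)^k * (integral\<^sup>L \<rho> (\<phi> k))\<^sup>2
          = (1/2)^k * (a * (1 - a) * (?u k - ?v k)\<^sup>2)" for k
        unfolding split[OF integrable_cont[OF \<rho> \<phi>(1)]] by (simp add: power2_eq_square algebra_simps)
      have summ_gap: "summable (\<lambda>k. (1/2)^k * (a * (1 - a) * (?u k - ?v k)\<^sup>2))"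
        unfolding gap[symmetric] by (intro summable_diff summable_add summable_mult summ inv \<rho>)
      have "a * \<Psi> \<rho>1 + (1 - a) * \<Psi> \<rho>2 - \<Psi> \<rho> = (\<Sum>k. (1/2)^k * (a * (1 - a) * (?u k - ?v k)\<^sup>2))"
        unfolding gap[symmetric] \<Psi>_def
        by (simp add: suminf_diff[symmetric] suminf_add[symmetric] suminf_mult[symmetric]
            summable_add summable_mult summ inv \<rho>)
      also have "\<dots> > 0"
        using a k by (intro suminf_pos2[OF summ_gap, of k]) auto
      finally have "\<Psi> \<rho> < a * \<Psi> \<rho>1 + (1 - a) * \<Psi> \<rho>2" by simp
      then have "\<eta> * \<Psi> \<rho> < \<eta> * (a * \<Psi> \<rho>1 + (1 - a) * \<Psi> \<rho>2)"
        using \<eta> by (rule mult_strict_left_mono)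
      then have "V \<rho> < a * V \<rho>1 + (1 - a) * V \<rho>2"
        unfolding V_def split[OF integrable_cont[OF \<rho> F]] by (simp add: algebra_simps)
      also have "\<dots> \<le> a * V \<rho> + (1 - a) * V \<rho>"
        using a max[OF inv(1)] max[OF inv(2)] by (intro add_mono mult_left_mono) auto
      finally show False by (simp add: algebra_simps)
    qed
    then have "integral\<^sup>L \<rho> F \<le> c" using erg \<rho> by blast
    moreover have "integral\<^sup>L \<tau> F \<le> V \<tau>" using \<Psi>_nonneg[OF \<tau>] \<eta> by (simp add: V_def)
    moreover have "V \<rho> \<le> integral\<^sup>L \<rho> F + \<eta> * 2"
      unfolding V_def using \<Psi>_le[OF \<rho>] \<eta> by simp
    ultimately show ?thesis using max[OF \<tau>] by simp
  qed
  show ?thesis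
  proof (rule field_le_epsilon)
    fix e :: real assume "e > 0"
    then show "integral\<^sup>L \<tau> F \<le> c + e" using main[of "e/2"] by simp
  qed
qed

section \<open>Averages along a Folner sequence\<close>

definition average :: "'g set \<Rightarrow> ('g \<Rightarrow> real) \<Rightarrow> real" where
  "average S a = (\<Sum>g\<in>S. a g) / real (card S)"

lemma average_const: "finite S \<Longrightarrow> S \<noteq> {} \<Longrightarrow> average S (\<lambda>_. c) = c"
  by (simp add: average_def)

lemma average_mono:
  assumes "\<And>g. g \<in> S \<Longrightarrow> a g \<le> b g"
  shows "average S a \<le> average S b"
  unfolding average_def by (intro divide_right_mono sum_mono assms) auto

lemma average_add: "average S (\<lambda>g. a g + b g) = average S a + average S b"
  by (simp add: average_def sum.distrib add_divide_distrib)

lemma average_diff: "average S (\<lambda>g. a g - b g) = average S a - average S b"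
  by (simp add: average_def sum_subtractf diff_divide_distrib)

lemma average_cmult: "average S (\<lambda>g. c * a g) = c * average S a"
  by (simp add: average_def sum_distrib_left[symmetric])

lemma average_divide: "average S (\<lambda>g. a g / c) = average S a / c"
  by (simp add: average_def sum_divide_distrib[symmetric] mult.commute)

lemma average_sum: "average S (\<lambda>g. \<Sum>i\<in>I. a i g) = (\<Sum>i\<in>I. average S (a i))"
  by (simp add: average_def sum.swap[of _ S] sum_divide_distrib)

lemma average_nonneg: "(\<And>g. 0 \<le> a g) \<Longrightarrow> 0 \<le> average S a"
  by (simp add: average_def sum_nonneg)

lemma sum_diff_le_card_sym_diff:
  fixes a :: "'g \<Rightarrow> real"
  assumes "finite S" "finite S'" "\<And>g. \<bar>a g\<bar> \<le> B"
  shows "\<bar>sum a S - sum a S'\<bar> \<le> B * real (card (sym_diff S S'))"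
proof -
  have "sum a S - sum a S' = sum a (S - S') - sum a (S' - S)"
    using assms(1,2) by (metis (no_types, lifting) add_diff_cancel_left Int_commute sum.Int_Diff)
  also have "\<bar>\<dots>\<bar> \<le> (\<Sum>g\<in>S - S'. \<bar>a g\<bar>) + (\<Sum>g\<in>S' - S. \<bar>a g\<bar>)"
    by (intro order_trans[OF abs_triangle_ineq4] add_mono sum_abs)
  also have "\<dots> = (\<Sum>g\<in>sym_diff S S'. \<bar>a g\<bar>)"
    using assms(1,2) by (intro sum.union_disjoint[symmetric]) auto
  also have "\<dots> \<le> (\<Sum>g\<in>sym_diff S S'. B)" by (intro sum_mono assms)
  finally show ?thesis by (simp add: mult.commute)
qed

text \<open>The Folner property in the form in which it makes limits of empirical measures invariant.\<close>
lemma folner_average_translate: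
  fixes a :: "'g::group_add \<Rightarrow> real"
  assumes F: "folner_sequence F" and B: "\<And>g. \<bar>a g\<bar> \<le> B"
  shows "(\<lambda>n. average (F n) (\<lambda>g. a (h + g)) - average (F n) a) \<longlonglongrightarrow> 0"
proof (rule tendsto_0_le[where K = B])
  show "(\<lambda>n. real (card (sym_diff ((+) h ` F n) (F n))) / real (card (F n))) \<longlonglongrightarrow> 0"
    using F by (simp add: folner_sequence_def)
  have "norm (average (F n) (\<lambda>g. a (h + g)) - average (F n) a)
      \<le> norm (real (card (sym_diff ((+) h ` F n) (F n))) / real (card (F n))) * B" for n
  proof -
    have fin: "finite (F n)" using F by (simp add: folner_sequence_def)
    have "(\<Sum>g\<in>F n. a (h + g)) = sum a ((+) h ` F n)"
      by (simp add: sum.reindex)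
    then have "average (F n) (\<lambda>g. a (h + g)) - average (F n) a = (sum a ((+) h ` F n) - sum a (F n)) / real (card (F n))"
      by (simp add: average_def diff_divide_distrib)
    also have "\<bar>\<dots>\<bar> \<le> (B * real (card (sym_diff ((+) h ` F n) (F n)))) / real (card (F n))"
      unfolding abs_divide using sum_diff_le_card_sym_diff[OF _ _ B, of "(+) h ` F n" "F n"] fin
      by (simp add: divide_right_mono)
    finally show ?thesis by (simp add: mult.commute)
  qed
  then show "\<forall>\<^sub>F n in sequentially. norm (average (F n) (\<lambda>g. a (h + g)) - average (F n) a)
      \<le> norm (real (card (sym_diff ((+) h ` F n) (F n))) / real (card (F n))) * B"
    by simp
qed

text \<open>
  If the averages exceeded \<open>c + e\<close> infinitely often, a weak limit of the corresponding empirical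
  measures would be an invariant measure with integral at least \<open>c + e\<close>, which
  \<open>integral_bound_from_ergodic\<close> excludes. The bound holds for every starting point \<open>z\<close>.
\<close>
theorem folner_average_le_ergodic_bound:
  fixes T :: "'g::group_add \<Rightarrow> 'z::{metric_space, second_countable_topology} \<Rightarrow> 'z" and \<Phi> :: "'z \<Rightarrow> real"
  assumes compact: "compact (UNIV :: 'z set)" and T: "continuous_action T" and F: "folner_sequence F" and \<Phi>: "continuous_on UNIV \<Phi>"
    and erg: "\<And>\<rho>. invariant_prob borel T \<rho> \<Longrightarrow> ergodic_for T \<rho> \<Longrightarrow> integral\<^sup>L \<rho> \<Phi> \<le> c"
    and e: "e > 0"
  shows "eventually (\<lambda>n. average (F n) (\<lambda>g. \<Phi> (T g z)) \<le> c + e) sequentially"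
proof (rule ccontr)
  assume "\<not> ?thesis"
  then obtain r0 :: "nat \<Rightarrow> nat" where r0: "strict_mono r0" "\<And>n. \<not> average (F (r0 n)) (\<lambda>g. \<Phi> (T g z)) \<le> c + e"
    using not_eventually_sequentiallyD[of "\<lambda>n. average (F n) (\<lambda>g. \<Phi> (T g z)) \<le> c + e"] by blast
  have T_cont: "continuous_on UNIV (T g)" for g using T by (simp add: continuous_action_def)
  have fin: "finite (F n)" "F n \<noteq> {}" for n using F by (auto simp: folner_sequence_def)
  define E where "E n = distr (uniform_count_measure (F (r0 n))) borel (\<lambda>g. T g z)" for n
  have m: "(\<lambda>g. T g z) \<in> measurable (uniform_count_measure (F (r0 n))) borel" for n
    by (simp add: measurable_def uniform_count_measure_def space_point_measure sets_point_measure)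
  have int_E: "integral\<^sup>L (E n) f = average (F (r0 n)) (\<lambda>g. f (T g z))"
    if "continuous_on UNIV f" for n and f :: "'z \<Rightarrow> real"
    unfolding E_def average_def using fin
    by (simp add: integral_distr[OF m borel_measurable_continuous_onI[OF that]] integral_uniform_count_measure)
  have prob_E: "prob_space (E n)" for n
    unfolding E_def using prob_space_uniform_count_measure[OF fin] m by (rule prob_space.prob_space_distr)
  have sets_E: "sets (E n) = sets borel" for n by (simp add: E_def)
  obtain \<rho> r where r: "strict_mono r" "prob_space \<rho>" "sets \<rho> = sets borel"
    and lim: "\<And>f :: 'z \<Rightarrow> real. continuous_on UNIV f \<Longrightarrow> (\<lambda>n. integral\<^sup>L (E (r n)) f) \<longlonglongrightarrow> integral\<^sup>L \<rho> f"
    by (rule weak_limit_exists[of E, OF compact prob_E sets_E]) (rule that)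
  have inv: "invariant_prob borel T \<rho>"
  proof (rule invariant_probI_integral[OF T_cont r(2,3)])
    fix h and f :: "'z \<Rightarrow> real" assume f: "continuous_on UNIV f"
    have fh: "continuous_on UNIV (\<lambda>z. f (T h z))" by (rule continuous_on_compose2[OF f T_cont]) simp
    obtain B where B: "\<And>z. \<bar>f z\<bar> \<le> B" using continuous_on_compact_bounded[OF compact f] by blast
    have "(\<lambda>n. average (F n) (\<lambda>g. f (T (h + g) z)) - average (F n) (\<lambda>g. f (T g z))) \<longlonglongrightarrow> 0"
      by (rule folner_average_translate[OF F B])
    then have "((\<lambda>n. average (F n) (\<lambda>g. f (T (h + g) z)) - average (F n) (\<lambda>g. f (T g z))) \<circ> (r0 \<circ> r)) \<longlonglongrightarrow> 0"
      by (rule LIMSEQ_subseq_LIMSEQ) (intro strict_mono_o r0 r)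
    moreover have "T (h + g) z = T h (T g z)" for g using T by (simp add: continuous_action_def)
    ultimately have "(\<lambda>n. integral\<^sup>L (E (r n)) (\<lambda>z. f (T h z)) - integral\<^sup>L (E (r n)) f) \<longlonglongrightarrow> 0"
      by (simp add: int_E f fh o_def)
    moreover have "(\<lambda>n. integral\<^sup>L (E (r n)) (\<lambda>z. f (T h z)) - integral\<^sup>L (E (r n)) f)
        \<longlonglongrightarrow> integral\<^sup>L \<rho> (\<lambda>z. f (T h z)) - integral\<^sup>L \<rho> f"
      by (intro tendsto_diff lim f fh)
    ultimately show "integral\<^sup>L \<rho> (\<lambda>z. f (T h z)) = integral\<^sup>L \<rho> f"
      using LIMSEQ_unique by fastforce
  qed
  have "c + e \<le> integral\<^sup>L \<rho> \<Phi>"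
    using r0(2) by (intro LIMSEQ_le_const[OF lim[OF \<Phi>]]) (auto simp: int_E \<Phi> less_imp_le not_le)
  moreover have "integral\<^sup>L \<rho> \<Phi> \<le> c"
    using integral_bound_from_ergodic[OF compact T_cont \<Phi> erg inv] .
  ultimately show False using e by simp
qed

lemma uniquely_ergodic_average_tendsto:
  fixes T :: "'g::group_add \<Rightarrow> 'z::{metric_space, second_countable_topology} \<Rightarrow> 'z" and f :: "'z \<Rightarrow> real"
  assumes compact: "compact (UNIV :: 'z set)" and T: "continuous_action T" and F: "folner_sequence F" and f: "continuous_on UNIV f"
    and unique: "\<And>\<rho>. invariant_prob borel T \<rho> \<Longrightarrow> \<rho> = \<mu>"
  shows "(\<lambda>n. average (F n) (\<lambda>g. f (T g z))) \<longlonglongrightarrow> integral\<^sup>L \<mu> f"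
proof (rule tendstoI)
  fix e :: real assume "e > 0"
  then have e2: "e/2 > 0" by simp
  have "integral\<^sup>L \<rho> f \<le> integral\<^sup>L \<mu> f" "integral\<^sup>L \<rho> (\<lambda>z. - f z) \<le> - integral\<^sup>L \<mu> f"
    if "invariant_prob borel T \<rho>" for \<rho> using unique[OF that] by auto
  then have "eventually (\<lambda>n. average (F n) (\<lambda>g. f (T g z)) \<le> integral\<^sup>L \<mu> f + e/2) sequentially"
    "eventually (\<lambda>n. average (F n) (\<lambda>g. - f (T g z)) \<le> - integral\<^sup>L \<mu> f + e/2) sequentially"
    using folner_average_le_ergodic_bound[OF compact T F f _ e2, of "integral\<^sup>L \<mu> f" z]
      folner_average_le_ergodic_bound[OF compact T F continuous_on_minus[OF f] _ e2, of "- integral\<^sup>L \<mu> f" z]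
    by blast+
  then show "eventually (\<lambda>n. dist (average (F n) (\<lambda>g. f (T g z))) (integral\<^sup>L \<mu> f) < e) sequentially"
  proof eventually_elim
    case (elim n)
    have "average (F n) (\<lambda>g. - f (T g z)) = - average (F n) (\<lambda>g. f (T g z))"
      by (simp add: average_def sum_negf)
    then show ?case using elim \<open>e > 0\<close> by (auto simp: dist_real_def abs_if)
  qed
qed

text \<open>
  A diagonal argument. If for every \<open>j\<close> the orbits were within \<open>1 / (j + 1)\<close> of each other for a
  proportion above \<open>\<delta>\<close> of some \<open>F (m j)\<close> with \<open>j \<le> m j\<close>, then the union of these sets of close times
  would have upper density at least \<open>\<delta>\<close>, and along it the distance would tend to \<open>0\<close>, because only
  finitely many of its elements come from the first few stages.
\<close>
lemma close_times_sparse_if_not_weakly_asymptotic: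
  fixes act :: "'g::group_add \<Rightarrow> 'x::metric_space \<Rightarrow> 'x"
  assumes F: "folner_sequence F" and xy: "x \<noteq> y" "\<not> weakly_asymptotic F act x y" and "\<delta> > 0"
  obtains \<epsilon> where "\<epsilon> > 0"
    "eventually (\<lambda>n. average (F n) (\<lambda>g. of_bool (dist (act g x) (act g y) < \<epsilon>)) \<le> \<delta>) sequentially"
proof (rule ccontr)
  define C where "C j n = {g \<in> F n. dist (act g x) (act g y) < 1 / Suc j}" for j n
  have fin: "finite (F n)" for n using F by (simp add: folner_sequence_def)
  assume "\<not> thesis"
  then have "\<not> eventually (\<lambda>n. average (F n) (\<lambda>g. of_bool (dist (act g x) (act g y) < 1 / Suc j)) \<le> \<delta>) sequentially" for j
    using that[of "1 / Suc j"] by auto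
  then have "\<exists>n\<ge>j. \<not> average (F n) (\<lambda>g. of_bool (dist (act g x) (act g y) < 1 / Suc j)) \<le> \<delta>" for j
    unfolding eventually_sequentially by blast
  then have "\<exists>n. j \<le> n \<and> \<delta> < card (C j n) / card (F n)" for j
    using fin by (simp add: average_def C_def Int_def not_le)
  then have "\<forall>j. \<exists>n. j \<le> n \<and> \<delta> < card (C j n) / card (F n)" by blast
  from choice[OF this] obtain m where m: "\<And>j. j \<le> m j" "\<And>j. \<delta> < card (C j (m j)) / card (F (m j))"
    by blast
  define D where "D = (\<Union>j. C j (m j))"
  have "upper_density F D > 0"
  proof (rule ccontr)
    assume "\<not> upper_density F D > 0"
    then have "upper_density F D \<le> 0" by simp
    then have "upper_density F D < ereal \<delta>"
      by (rule order.strict_trans1[of _ 0]) (use \<open>\<delta> > 0\<close> in simp_all)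
    then have "eventually (\<lambda>n. ereal (real (card (F n \<inter> D)) / real (card (F n))) < ereal \<delta>) sequentially"
      unfolding upper_density_def by (rule Limsup_lessD)
    then obtain N where N: "\<And>n. n \<ge> N \<Longrightarrow> real (card (F n \<inter> D)) / real (card (F n)) < \<delta>"
      by (auto simp: eventually_sequentially)
    have "card (C N (m N)) \<le> card (F (m N) \<inter> D)"
      using fin by (intro card_mono) (auto simp: D_def C_def)
    then have "\<delta> < real (card (F (m N) \<inter> D)) / real (card (F (m N)))"
      by (intro order_less_le_trans[OF m(2)[of N]] divide_right_mono) simp_all
    then show False using N[OF m(1)[of N]] by simp
  qed
  moreover have "((\<lambda>g. dist (act g x) (act g y)) \<longlongrightarrow> 0) (inf cofinite (principal D))"
  proof (rule tendstoI)
    fix e :: real assume "e > 0"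
    then obtain k where k: "1 / Suc k < e" using nat_approx_posE by blast
    have "g \<in> (\<Union>j<k. F (m j))" if "g \<in> D" "\<not> dist (dist (act g x) (act g y)) 0 < e" for g
    proof -
      obtain j where j: "g \<in> F (m j)" "dist (act g x) (act g y) < 1 / Suc j"
        using \<open>g \<in> D\<close> unfolding D_def C_def by blast
      have "j < k"
      proof (rule ccontr)
        assume "\<not> j < k"
        then have "1 / Suc j \<le> 1 / real (Suc k)" by (intro divide_left_mono) auto
        then show False using j(2) k that(2) by simp
      qed
      then show ?thesis using j(1) by blast
    qed
    then have "{g. \<not> (g \<in> D \<longrightarrow> dist (dist (act g x) (act g y)) 0 < e)} \<subseteq> (\<Union>j<k. F (m j))"
      by blast
    moreover have "finite (\<Union>j<k. F (m j))" using fin by simp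
    ultimately have "finite {g. \<not> (g \<in> D \<longrightarrow> dist (dist (act g x) (act g y)) 0 < e)}"
      by (rule finite_subset)
    then show "eventually (\<lambda>g. dist (dist (act g x) (act g y)) 0 < e) (inf cofinite (principal D))"
      by (simp add: eventually_inf_principal eventually_cofinite)
  qed
  ultimately show False using xy by (auto simp: weakly_asymptotic_def)
qed

section \<open>Ergodic joinings of two copies\<close>

lemma filterlim_uminus_cofinite: "filterlim uminus cofinite (cofinite :: 'g::group_add filter)"
  unfolding filterlim_iff
proof (intro allI impI)
  fix P :: "'g \<Rightarrow> bool" assume "eventually P cofinite"
  then have "finite (uminus -` {x. \<not> P x})" by (intro finite_vimageI) (simp_all add: eventually_cofinite)
  then show "eventually (\<lambda>x. P (- x)) cofinite" by (simp add: eventually_cofinite vimage_def)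
qed

text \<open>
  Since \<open>\<mu>\<close> is invariant, only the difference \<open>h - g\<close> matters, and mixing of two sets is convergence
  along the cofinite filter in this difference, which leaves a finite exceptional set.
\<close>
lemma mixing_intersection_bound:
  fixes act :: "'g::ab_group_add \<Rightarrow> 'x::metric_space \<Rightarrow> 'x"
  assumes act: "continuous_action act" and inv: "invariant_prob borel act \<mu>"
    and mix: "mixing_all_orders act \<mu>" and U: "U \<in> sets borel" and e: "e > 0"
  obtains S where "finite S" "\<And>g h. h - g \<notin> S \<Longrightarrow>
    measure \<mu> {x. act g x \<in> U \<and> act h x \<in> U} \<le> (measure \<mu> U)\<^sup>2 + e"
proof -
  \<comment> \<open>embeds the group into index tuples so that the filter of the definition pulls back to the cofinite filter\<close>
  define u where "u h = (\<lambda>i::nat. if i = 0 then 0 else h)" for h :: 'g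
  have lim: "((\<lambda>g. measure \<mu> (\<Inter>i\<le>1. act (g i) ` U)) \<longlongrightarrow> (\<Prod>i\<le>(1::nat). measure \<mu> U))
      (INF (i, j)\<in>{(i, j). i \<le> 1 \<and> j \<le> 1 \<and> i \<noteq> j}. filtercomap (\<lambda>g :: nat \<Rightarrow> 'g. - g i + g j) cofinite)"
    by (rule mix[unfolded mixing_all_orders_def, rule_format, of 1 "\<lambda>_. U"]) (use U in simp_all)
  have "filterlim u (INF (i, j)\<in>{(i, j). i \<le> 1 \<and> j \<le> 1 \<and> i \<noteq> j}.
      filtercomap (\<lambda>g :: nat \<Rightarrow> 'g. - g i + g j) cofinite) cofinite"
    unfolding filterlim_INF
  proof safe
    fix i j :: nat assume ij: "i \<le> 1" "j \<le> 1" "i \<noteq> j"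
    then consider "i = 0" "j = 1" | "i = 1" "j = 0" by linarith
    then show "filterlim u (filtercomap (\<lambda>g :: nat \<Rightarrow> 'g. - g i + g j) cofinite) cofinite"
    proof cases
      case 1
      then show ?thesis
        by (simp add: filterlim_filtercomap_iff o_def u_def filterlim_ident)
    next
      case 2
      then show ?thesis
        by (simp add: filterlim_filtercomap_iff o_def u_def filterlim_uminus_cofinite)
    qed
  qed
  then have "((\<lambda>h. measure \<mu> (\<Inter>i\<le>1. act (u h i) ` U)) \<longlongrightarrow> (\<Prod>i\<le>(1::nat). measure \<mu> U)) cofinite"
    using filterlim_compose[OF lim] by blast
  moreover have act0: "act 0 x = x" for x using act by (simp add: continuous_action_def)
  then have "(\<Inter>i\<le>1. act (u h i) ` U) = U \<inter> act h ` U" for h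
    by (simp add: u_def atMost_Suc Int_commute)
  ultimately have "((\<lambda>h. measure \<mu> (U \<inter> act h ` U)) \<longlongrightarrow> (measure \<mu> U)\<^sup>2) cofinite"
    by (simp add: atMost_Suc power2_eq_square)
  from tendstoD[OF this e] have "eventually (\<lambda>h. measure \<mu> (U \<inter> act h ` U) \<le> (measure \<mu> U)\<^sup>2 + e) cofinite"
    by eventually_elim (simp add: dist_real_def)
  then have fin: "finite {h. \<not> measure \<mu> (U \<inter> act h ` U) \<le> (measure \<mu> U)\<^sup>2 + e}" (is "finite ?S")
    by (simp add: eventually_cofinite)
  show thesis
  proof (rule that)
    show "finite (uminus ` ?S)" using fin by (rule finite_imageI)
    fix g h assume "h - g \<notin> uminus ` ?S"
    then have *: "measure \<mu> (U \<inter> act (g - h) ` U) \<le> (measure \<mu> U)\<^sup>2 + e"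
      by (metis (mono_tags, lifting) image_eqI mem_Collect_eq minus_diff_eq)
    have comp: "act (a + b) x = act a (act b x)" for a b x using act by (simp add: continuous_action_def)
    have img: "y \<in> act (g - h) ` U \<longleftrightarrow> act (h - g) y \<in> U" for y
    proof
      show "act (h - g) y \<in> U" if "y \<in> act (g - h) ` U"
        using that comp[of "h - g" "g - h"] act0 by auto
      show "y \<in> act (g - h) ` U" if "act (h - g) y \<in> U"
        using that comp[of "g - h" "h - g" y] act0 by (metis (no_types, lifting) image_eqI add.commute diff_add_cancel diff_self add_diff_eq)
    qed
    have "{x. act g x \<in> U \<and> act h x \<in> U} = act g -` (U \<inter> act (g - h) ` U)"
      using comp[of "h - g" g] by (simp add: set_eq_iff img)
    moreover have "U \<inter> act (g - h) ` U = U \<inter> act (h - g) -` U" using img by blast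
    moreover have m: "act k \<in> measurable borel borel" for k using inv by (simp add: invariant_prob_def)
    then have "U \<inter> act (h - g) -` U \<in> sets borel" using U measurable_sets[OF m U] by auto
    moreover have s: "sets \<mu> = sets borel" "distr \<mu> borel (act g) = \<mu>" using inv by (auto simp: invariant_prob_def)
    moreover have "act g \<in> measurable \<mu> borel" using m s(1) by (simp cong: measurable_cong_sets)
    ultimately have "measure \<mu> {x. act g x \<in> U \<and> act h x \<in> U} = measure \<mu> (U \<inter> act (g - h) ` U)"
      using measure_distr[of "act g" \<mu> borel "U \<inter> act (g - h) ` U"] sets_eq_imp_space_eq[OF s(1)] by simp
    then show "measure \<mu> {x. act g x \<in> U \<and> act h x \<in> U} \<le> (measure \<mu> U)\<^sup>2 + e" using * by simp
  qed
qed

definition pair_act :: "('g \<Rightarrow> 'x \<Rightarrow> 'x) \<Rightarrow> 'g \<Rightarrow> 'x \<times> 'x \<Rightarrow> 'x \<times> 'x" where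
  "pair_act act g = map_prod (act g) (act g)"

lemma off_diagonal_joining_eq_distr:
  fixes act :: "'g \<Rightarrow> 'x::topological_space \<Rightarrow> 'x"
  assumes s: "sets \<mu> = sets borel" and m: "\<And>g. act g \<in> measurable borel borel"
  shows "off_diagonal_joining act \<mu> I g = distr \<mu> (PiM I (\<lambda>_. borel)) (\<lambda>x. \<lambda>i\<in>I. act (g i) x)"
proof -
  have m1: "(\<lambda>x. \<lambda>i\<in>I. x) \<in> measurable \<mu> (PiM I (\<lambda>_. borel))"
    by (rule measurable_restrict) (simp add: measurable_cong_sets[OF s refl])
  have m2: "(\<lambda>x. \<lambda>i\<in>I. act (g i) (x i)) \<in> measurable (PiM I (\<lambda>_. borel)) (PiM I (\<lambda>_. borel))"
  proof (rule measurable_restrict)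
    fix i assume "i \<in> I"
    then show "(\<lambda>x. act (g i) (x i)) \<in> measurable (PiM I (\<lambda>_. borel)) borel"
      using m[of "g i"] by (rule measurable_compose[OF measurable_component_singleton])
  qed
  show ?thesis
    unfolding off_diagonal_joining_def diagonal_joining_def
    by (subst distr_distr[OF m2 m1]) (auto simp: o_def intro!: distr_cong restrict_ext)
qed

text \<open>
  By unique ergodicity both marginals of an invariant measure on the square are \<open>\<mu>\<close>, so an ergodic
  one is a two-fold ergodic self-joining. The partition of the two coordinates given by minimal
  self-joinings has two blocks (independence) or one block (a graph). The self-joinings live on
  functions on \<open>{..<2}\<close>, so the proof consists of transporting the measure there and back.
\<close>
theorem ergodic_pair_joining_cases:
  fixes act :: "'g \<Rightarrow> 'x::{metric_space, second_countable_topology} \<Rightarrow> 'x"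
  assumes act: "\<And>g. act g \<in> measurable borel borel" and inv: "invariant_prob borel act \<mu>"
    and unique: "\<And>\<nu>. invariant_prob borel act \<nu> \<Longrightarrow> \<nu> = \<mu>"
    and msj: "minimal_self_joinings act \<mu>"
    and \<rho>: "invariant_prob borel (pair_act act) \<rho>" "ergodic_for (pair_act act) \<rho>"
  obtains
    (independent) "\<And>f :: 'x \<Rightarrow> real. f \<in> borel_measurable borel \<Longrightarrow> (\<And>x. \<bar>f x\<bar> \<le> 1) \<Longrightarrow>
      integral\<^sup>L \<rho> (\<lambda>z. f (fst z) * f (snd z)) = (integral\<^sup>L \<mu> f)\<^sup>2"
  | (graph) g h where "\<rho> = distr \<mu> borel (\<lambda>x. (act g x, act h x))"
proof -
  interpret \<rho>: prob_space \<rho> using \<rho>(1) by (simp add: invariant_prob_def)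
  interpret \<mu>: prob_space \<mu> using inv by (simp add: invariant_prob_def)
  note act [measurable]
  have s\<rho> [measurable_cong]: "sets \<rho> = sets borel" using \<rho>(1) by (simp add: invariant_prob_def)
  have s\<mu> [measurable_cong]: "sets \<mu> = sets borel" using inv by (simp add: invariant_prob_def)
  have sp\<rho>: "space \<rho> = UNIV" using sets_eq_imp_space_eq[OF s\<rho>] by simp
  have act_\<rho>: "distr \<rho> borel (pair_act act g) = \<rho>" for g using \<rho>(1) by (simp add: invariant_prob_def)
  have [measurable]: "fst \<in> borel_measurable (borel :: ('x \<times> 'x) measure)" "snd \<in> borel_measurable (borel :: ('x \<times> 'x) measure)"
    by (intro borel_measurable_continuous_onI continuous_intros)+
  have [measurable]: "pair_act act g \<in> measurable borel borel" for g
    using \<rho>(1) by (simp add: invariant_prob_def)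
  define P where "P = PiM {..<2::nat} (\<lambda>_. borel :: 'x measure)"
  define emb where "emb z = (\<lambda>i\<in>{..<2::nat}. if i = 0 then fst z else snd z)" for z :: "'x \<times> 'x"
  define unpair where "unpair w = (w 0, w 1)" for w :: "nat \<Rightarrow> 'x"
  have emb_m [measurable]: "emb \<in> measurable borel P"
    unfolding emb_def P_def by (rule measurable_restrict) simp
  have unpair_m [measurable]: "unpair \<in> measurable P borel"
    unfolding unpair_def P_def borel_prod[symmetric] by measurable
  have unpair_emb: "unpair (emb z) = z" for z by (simp add: unpair_def emb_def)
  have diag_emb: "diagonal_act {..<2} act g (emb z) = emb (pair_act act g z)" for g z
    by (auto simp: diagonal_act_def emb_def pair_act_def intro!: restrict_ext)
  have diag_m [measurable]: "diagonal_act {..<2} act g \<in> measurable P P" for g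
    unfolding diagonal_act_def[abs_def] P_def by measurable
  define \<rho>' where "\<rho>' = distr \<rho> P emb"
  have sp\<rho>': "space \<rho>' = space P" by (simp add: \<rho>'_def)
  have \<rho>_unpair: "\<rho> = distr \<rho>' borel unpair"
    unfolding \<rho>'_def by (subst distr_distr) (auto simp: o_def unpair_emb s\<rho> distr_id2)
  have marginal: "distr \<rho> borel p = \<mu>" if p: "p \<in> {fst, snd}" for p
  proof (rule unique, unfold invariant_prob_def, intro conjI allI)
    have [measurable]: "p \<in> measurable borel borel" using p by auto
    show "prob_space (distr \<rho> borel p)" by (rule \<rho>.prob_space_distr) measurable
    fix g
    have "distr (distr \<rho> borel p) borel (act g) = distr \<rho> borel (p \<circ> pair_act act g)"
      using p by (subst distr_distr) (auto simp: pair_act_def o_def)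
    also have "\<dots> = distr (distr \<rho> borel (pair_act act g)) borel p"
      by (subst distr_distr) (auto simp: s\<rho>)
    finally show "distr (distr \<rho> borel p) borel (act g) = distr \<rho> borel p" using act_\<rho> by simp
  qed (use act in auto)
  have "self_joining act \<mu> 2 \<rho>'"
    unfolding self_joining_def invariant_prob_def P_def[symmetric]
  proof (intro conjI allI impI)
    show "prob_space \<rho>'" unfolding \<rho>'_def by (rule \<rho>.prob_space_distr) measurable
    fix g
    have "distr \<rho>' P (diagonal_act {..<2} act g) = distr \<rho> P (emb \<circ> pair_act act g)"
      unfolding \<rho>'_def by (subst distr_distr) (auto simp: o_def diag_emb)
    also have "\<dots> = distr (distr \<rho> borel (pair_act act g)) P emb"
      by (subst distr_distr) (auto simp: s\<rho>)
    finally show "distr \<rho>' P (diagonal_act {..<2} act g) = \<rho>'" using act_\<rho> by (simp add: \<rho>'_def)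
  next
    fix i :: nat assume i: "i < 2"
    have "distr \<rho>' borel (\<lambda>w. w i) = distr \<rho> borel (if i = 0 then fst else snd)"
    proof -
      have w: "(\<lambda>w. w i) \<in> measurable P borel" unfolding P_def using i by simp
      have "emb \<in> measurable \<rho> P" by measurable
      then show ?thesis
        unfolding \<rho>'_def using i by (subst distr_distr[OF w]) (auto simp: o_def emb_def intro!: distr_cong)
    qed
    then show "distr \<rho>' borel (\<lambda>w. w i) = \<mu>" using marginal by auto
  qed (auto simp: \<rho>'_def)
  moreover have "ergodic_for (diagonal_act {..<2} act) \<rho>'"
    unfolding ergodic_for_def
  proof (intro ballI impI)
    fix A assume A: "A \<in> sets \<rho>'" "\<forall>g. diagonal_act {..<2} act g -` A \<inter> space \<rho>' = A"
    have AP: "A \<in> sets P" using A(1) by (simp add: \<rho>'_def)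
    have E: "emb -` A \<in> sets \<rho>" using measurable_sets[OF emb_m AP] by (simp add: s\<rho>)
    have "pair_act act g -` (emb -` A) \<inter> space \<rho> = emb -` A" for g
    proof -
      have "emb z \<in> space \<rho>'" for z using measurable_space[OF emb_m, of z] by (simp add: sp\<rho>')
      then have "emb z \<in> A \<longleftrightarrow> diagonal_act {..<2} act g (emb z) \<in> A" for z using A(2) by blast
      then show ?thesis by (auto simp: diag_emb sp\<rho>)
    qed
    then have "measure \<rho> (emb -` A) = 0 \<or> measure \<rho> (emb -` A) = 1"
      using \<rho>(2) E by (auto simp: ergodic_for_def)
    then show "measure \<rho>' A = 0 \<or> measure \<rho>' A = 1"
      using AP by (simp add: \<rho>'_def measure_distr sp\<rho>)
  qed
  ultimately have "trivial_joining act \<mu> 2 \<rho>'" using msj by (auto simp: minimal_self_joinings_def)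
  then obtain k :: nat and b g where b: "b ` {..<2} = {..<k}"
    and eq: "\<rho>' = distr (PiM {..<k} (\<lambda>j. off_diagonal_joining act \<mu> {i. i < 2 \<and> b i = j} g))
                  P (\<lambda>w. \<lambda>i\<in>{..<2}. w (b i) i)"
    unfolding trivial_joining_def P_def by blast
  define I where "I j = {i. i < 2 \<and> b i = j}" for j
  define D where "D j = off_diagonal_joining act \<mu> (I j) g" for j
  have D_eq: "D j = distr \<mu> (PiM (I j) (\<lambda>_. borel)) (\<lambda>x. \<lambda>i\<in>I j. act (g i) x)" for j
    unfolding D_def by (rule off_diagonal_joining_eq_distr[OF s\<mu> act])
  have Dm [measurable]: "(\<lambda>x. \<lambda>i\<in>I j. act (g i) x) \<in> measurable \<mu> (PiM (I j) (\<lambda>_. borel))" for j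
    by (rule measurable_restrict) measurable
  have D_prob: "prob_space (D j)" for j unfolding D_eq using Dm by (rule \<mu>.prob_space_distr)
  have sD [measurable_cong]: "sets (D j) = sets (PiM (I j) (\<lambda>_. borel))" for j by (simp add: D_eq)
  interpret D: product_prob_space D "{..<k}"
    by (rule product_prob_spaceI) (rule D_prob)
  have b01: "b 0 < k" "b 1 < k" using b by auto
  have I_b: "i \<in> I (b i)" if "i < 2" for i using that by (simp add: I_def)
  have coord [measurable]: "(\<lambda>w. w (b i) i) \<in> measurable (PiM {..<k} D) borel" if "i < 2" for i
  proof -
    have "b i < k" using b that by blast
    then have "(\<lambda>w. w (b i)) \<in> measurable (PiM {..<k} D) (D (b i))" by simp
    moreover have "(\<lambda>v. v i) \<in> measurable (D (b i)) borel"
      unfolding measurable_cong_sets[OF sD refl] using I_b[OF that] by simp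
    ultimately show ?thesis by (rule measurable_compose)
  qed
  have m2: "(\<lambda>w. \<lambda>i\<in>{..<2}. w (b i) i) \<in> measurable (PiM {..<k} D) P"
    unfolding P_def by (rule measurable_restrict) (use coord in auto)
  have eq': "\<rho>' = distr (PiM {..<k} D) P (\<lambda>w. \<lambda>i\<in>{..<2}. w (b i) i)"
  proof -
    have "D = (\<lambda>j. off_diagonal_joining act \<mu> {i. i < 2 \<and> b i = j} g)" by (simp add: D_def I_def fun_eq_iff)
    then show ?thesis using eq by simp
  qed
  have \<rho>_eq: "\<rho> = distr (PiM {..<k} D) borel (\<lambda>w. (w (b 0) 0, w (b 1) 1))"
    unfolding \<rho>_unpair eq' by (subst distr_distr[OF unpair_m m2]) (auto simp: unpair_def o_def)
  show thesis
  proof (cases "b 0 = b 1")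
    case True
    have comp: "distr (PiM {..<k} D) (D (b 0)) (\<lambda>w. w (b 0)) = D (b 0)"
      using b01 by (intro D.PiM_component) auto
    have m01: "(\<lambda>v. (v 0, v 1)) \<in> measurable (D (b 0)) (borel :: ('x \<times> 'x) measure)"
      unfolding measurable_cong_sets[OF sD refl] borel_prod[symmetric]
      using I_b[of 0] I_b[of 1] True by (intro measurable_Pair measurable_component_singleton) auto
    have "\<rho> = distr (distr (PiM {..<k} D) (D (b 0)) (\<lambda>w. w (b 0))) borel (\<lambda>v. (v 0, v 1))"
      unfolding \<rho>_eq using b01 True by (subst distr_distr[OF m01]) (auto simp: o_def)
    also have "\<dots> = distr (D (b 0)) borel (\<lambda>v. (v 0, v 1))" by (simp only: comp)
    also have "\<dots> = distr \<mu> borel (\<lambda>x. (act (g 0) x, act (g 1) x))"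
      unfolding D_eq using m01 I_b[of 0] I_b[of 1] True
      by (subst distr_distr[OF _ Dm]) (auto simp: o_def measurable_cong_sets[OF sD refl])
    finally show thesis by (rule graph)
  next
    case False
    have k2: "{..<k} = {b 0, b 1}" using b by (auto simp: lessThan_Suc numeral_2_eq_2)
    show thesis
    proof (rule independent)
      fix f :: "'x \<Rightarrow> real" assume f [measurable]: "f \<in> borel_measurable borel" and f1: "\<And>x. \<bar>f x\<bar> \<le> 1"
      define F where "F j v = f (v (if j = b 0 then 0 else 1 :: nat))" for j and v :: "nat \<Rightarrow> 'x"
      have vi: "(\<lambda>v. v i) \<in> measurable (D (b i)) borel" if "i < 2" for i
        unfolding measurable_cong_sets[OF sD refl] using I_b[OF that] by simp
      have int_coord: "integral\<^sup>L (D (b i)) (\<lambda>v. f (v i)) = integral\<^sup>L \<mu> f" if "i < 2" for i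
      proof -
        have "(\<lambda>v. f (v i)) \<in> borel_measurable (PiM (I (b i)) (\<lambda>_. borel))"
          using I_b[OF that] by measurable
        then have "integral\<^sup>L (D (b i)) (\<lambda>v. f (v i)) = integral\<^sup>L \<mu> (\<lambda>x. f (act (g i) x))"
          unfolding D_eq using I_b[OF that] by (subst integral_distr[OF Dm]) auto
        then show ?thesis using invariant_prob_integral[OF inv f] by simp
      qed
      have F_int: "integrable (D j) (F j)" if "j \<in> {..<k}" for j
      proof -
        have "F j \<in> borel_measurable (D j)"
          using that k2 measurable_compose[OF vi[of 0] f] measurable_compose[OF vi[of 1] f] False
          by (auto simp: F_def[abs_def])
        then show ?thesis
          using f1 by (intro finite_measure.integrable_const_bound[OF prob_space.axioms(1)[OF D_prob], of _ 1])
            (auto simp: F_def)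
      qed
      have "integral\<^sup>L \<rho> (\<lambda>z. f (fst z) * f (snd z)) = integral\<^sup>L (PiM {..<k} D) (\<lambda>w. f (w (b 0) 0) * f (w (b 1) 1))"
        unfolding \<rho>_eq using coord[of 0] coord[of 1]
        by (subst integral_distr) (auto simp: borel_prod[symmetric])
      also have "\<dots> = integral\<^sup>L (PiM {..<k} D) (\<lambda>w. \<Prod>j\<in>{..<k}. F j (w j))"
        unfolding k2 using False by (simp add: F_def)
      also have "\<dots> = (\<Prod>j\<in>{..<k}. integral\<^sup>L (D j) (F j))"
        using F_int by (intro D.product_integral_prod) auto
      also have "\<dots> = integral\<^sup>L (D (b 0)) (\<lambda>v. f (v 0)) * integral\<^sup>L (D (b 1)) (\<lambda>v. f (v 1))"
        unfolding k2 using False by (simp add: F_def[abs_def])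
      finally show "integral\<^sup>L \<rho> (\<lambda>z. f (fst z) * f (snd z)) = (integral\<^sup>L \<mu> f)\<^sup>2"
        using int_coord[of 0] int_coord[of 1] by (simp add: power2_eq_square)
    qed
  qed
qed

section \<open>Correlations along pairs of orbits\<close>

lemma continuous_action_pair_act:
  assumes "continuous_action act"
  shows "continuous_action (pair_act act)"
proof -
  have c: "continuous_on UNIV (act g)" for g using assms by (simp add: continuous_action_def)
  have "continuous_on UNIV (\<lambda>z. act g (fst z))" "continuous_on UNIV (\<lambda>z. act g (snd z))" for g
    by (rule continuous_on_compose2[OF c continuous_on_fst[OF continuous_on_id]]; simp)
       (rule continuous_on_compose2[OF c continuous_on_snd[OF continuous_on_id]]; simp)
  then have "continuous_on UNIV (pair_act act g)" for g
    unfolding pair_act_def map_prod_def case_prod_unfold by (rule continuous_on_Pair)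
  then show ?thesis
    using assms by (simp add: continuous_action_def pair_act_def map_prod_def case_prod_unfold)
qed

text \<open>
  The cutoff function \<open>\<theta>\<close> vanishes on the graphs of the finitely many \<open>s \<in> S\<close> for which mixing gives
  no bound, and equals \<open>1\<close> away from them. The product \<open>\<Phi>\<close> of \<open>f \<otimes> f\<close> with \<open>\<theta>\<close> has integral at most
  \<open>q\<^sup>2 + e/3\<close> for every ergodic joining, hence almost this bound for orbit averages. The
  difference between \<open>f \<otimes> f\<close> and \<open>\<Phi>\<close> is supported where the orbit of \<open>y\<close> is close to the orbit of some
  \<open>s x\<close>, which is rare.
\<close>
theorem pair_average_bound:
  fixes act :: "'g::ab_group_add \<Rightarrow> 'x::compact_metric_space \<Rightarrow> 'x" and f :: "'x \<Rightarrow> real"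
  assumes act: "continuous_action act" and inv: "invariant_prob borel act \<mu>"
    and F: "folner_sequence F"
    and unique: "\<And>\<nu>. invariant_prob borel act \<nu> \<Longrightarrow> \<nu> = \<mu>"
    and mix: "mixing_all_orders act \<mu>" and msj: "minimal_self_joinings act \<mu>"
    and nwa: "\<And>x y. \<not> weakly_asymptotic F act x y"
    and U: "U \<in> sets borel"
    and f: "continuous_on UNIV f" "\<And>x. 0 \<le> f x" "\<And>x. f x \<le> indicator U x"
    and e: "e > 0"
  obtains S where "finite S"
    "\<And>x y. y \<notin> (\<lambda>s. act s x) ` S \<Longrightarrow>
       eventually (\<lambda>n. average (F n) (\<lambda>g. f (act g x) * f (act g y)) \<le> (measure \<mu> U)\<^sup>2 + e) sequentially"
proof -
  let ?q = "measure \<mu> U"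
  interpret \<mu>: prob_space \<mu> using inv by (simp add: invariant_prob_def)
  have s\<mu>: "sets \<mu> = sets borel" using inv by (simp add: invariant_prob_def)
  have act_m [measurable]: "act g \<in> measurable borel borel" for g using inv by (simp add: invariant_prob_def)
  have act_c: "continuous_on UNIV (act g)" for g using act by (simp add: continuous_action_def)
  have act_add: "act (g + h) x = act g (act h x)" for g h x using act by (simp add: continuous_action_def)
  have f1: "f x \<le> 1" for x by (rule order_trans[OF f(3) indicator_le_1])
  have f_abs: "\<bar>f x\<bar> \<le> 1" for x using f(2)[of x] f1[of x] by simp
  have f_m [measurable]: "f \<in> borel_measurable borel" using f(1) by (rule borel_measurable_continuous_onI)
  have fU: "f x = 0" if "x \<notin> U" for x using f(2)[of x] f(3)[of x] that by simp
  have compact2: "compact (UNIV :: ('x \<times> 'x) set)"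
    using compact_Times[OF compact_UNIV_metric compact_UNIV_metric] by simp
  obtain S where S: "finite S" "\<And>g h. h - g \<notin> S \<Longrightarrow>
    measure \<mu> {x. act g x \<in> U \<and> act h x \<in> U} \<le> ?q\<^sup>2 + e/3"
    using mixing_intersection_bound[OF act inv mix U, of "e/3"] e by auto
  show thesis
  proof (rule that[OF S(1)])
    fix x y assume y: "y \<notin> (\<lambda>s. act s x) ` S"
    \<comment> \<open>the \<open>card S\<close> cutoff errors together cost at most \<open>e/3\<close>; the \<open>+ 1\<close> covers empty \<open>S\<close>\<close>
    define \<delta> where "\<delta> = e / (3 * (real (card S) + 1))"
    have \<delta>: "\<delta> > 0" using e by (simp add: \<delta>_def add_nonneg_pos)
    have "\<exists>\<epsilon>. \<epsilon> > 0 \<and> eventually (\<lambda>n. average (F n)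
        (\<lambda>g. of_bool (dist (act g (act s x)) (act g y) < \<epsilon>)) \<le> \<delta>) sequentially" if "s \<in> S" for s
    proof -
      have "act s x \<noteq> y" using y that by blast
      then show ?thesis
        using close_times_sparse_if_not_weakly_asymptotic[OF F _ nwa \<delta>, of "act s x" y] by metis
    qed
    then obtain \<epsilon> where \<epsilon>: "\<And>s. s \<in> S \<Longrightarrow> \<epsilon> s > 0"
      "\<And>s. s \<in> S \<Longrightarrow> eventually (\<lambda>n. average (F n)
        (\<lambda>g. of_bool (dist (act g (act s x)) (act g y) < \<epsilon> s)) \<le> \<delta>) sequentially"
      by metis
    define \<theta> where "\<theta> z = (\<Prod>s\<in>S. min 1 (dist (act s (fst z)) (snd z) / \<epsilon> s))" for z
    define \<Phi> where "\<Phi> z = f (fst z) * f (snd z) * \<theta> z" for z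
    have \<theta>_range: "0 \<le> \<theta> z" "\<theta> z \<le> 1" for z
      unfolding \<theta>_def using \<epsilon>(1) by (auto intro!: prod_nonneg prod_le_1 simp: less_imp_le)
    have \<Phi>_le: "\<Phi> z \<le> f (fst z) * f (snd z)" "0 \<le> \<Phi> z" for z
      unfolding \<Phi>_def using \<theta>_range[of z] f(2) by (auto intro!: mult_left_le)
    have ff_le: "f a * f b \<le> 1" for a b using f(2) f1 by (intro mult_le_one) auto
    have f_fst: "continuous_on UNIV (\<lambda>z :: 'x \<times> 'x. f (fst z))" "continuous_on UNIV (\<lambda>z :: 'x \<times> 'x. f (snd z))"
      by (rule continuous_on_compose2[OF f(1)]; (intro continuous_intros)?; simp)+
    have act_fst: "continuous_on UNIV (\<lambda>z :: 'x \<times> 'x. act s (fst z))" for s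
      by (rule continuous_on_compose2[OF act_c]; (intro continuous_intros)?; simp)
    have \<Phi>_c: "continuous_on UNIV \<Phi>"
      unfolding \<Phi>_def[abs_def] \<theta>_def[abs_def] divide_inverse
      by (intro continuous_intros f_fst act_fst)
    have "integral\<^sup>L \<rho> \<Phi> \<le> ?q\<^sup>2 + e/3"
      if \<rho>: "invariant_prob borel (pair_act act) \<rho>" "ergodic_for (pair_act act) \<rho>" for \<rho>
    proof -
      interpret \<rho>: prob_space \<rho> using \<rho>(1) by (simp add: invariant_prob_def)
      have s\<rho>: "sets \<rho> = sets borel" using \<rho>(1) by (simp add: invariant_prob_def)
      have cont_int: "integrable \<rho> h" if "continuous_on UNIV h" "\<And>z. \<bar>h z\<bar> \<le> 1" for h :: "'x \<times> 'x \<Rightarrow> real"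
        using that by (intro \<rho>.integrable_const_bound[of _ 1])
          (auto simp: measurable_cong_sets[OF s\<rho> refl] intro: borel_measurable_continuous_onI)
      consider (independent) "integral\<^sup>L \<rho> (\<lambda>z. f (fst z) * f (snd z)) = (integral\<^sup>L \<mu> f)\<^sup>2"
        | (graph) g h where "\<rho> = distr \<mu> borel (\<lambda>x. (act g x, act h x))"
      proof (rule ergodic_pair_joining_cases[OF act_m inv unique msj \<rho>])
        assume "\<And>f :: 'x \<Rightarrow> real. f \<in> borel_measurable borel \<Longrightarrow> (\<And>x. \<bar>f x\<bar> \<le> 1) \<Longrightarrow>
          integral\<^sup>L \<rho> (\<lambda>z. f (fst z) * f (snd z)) = (integral\<^sup>L \<mu> f)\<^sup>2"
        from this[OF f_m f_abs] show thesis by (rule that(1))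
      qed (assumption | erule that(2))+
      then show ?thesis
      proof cases
        case independent
        have "integral\<^sup>L \<rho> \<Phi> \<le> integral\<^sup>L \<rho> (\<lambda>z. f (fst z) * f (snd z))"
          using \<Phi>_le ff_le f(2) order_trans[OF \<Phi>_le(1) ff_le]
          by (intro integral_mono cont_int \<Phi>_c continuous_intros f_fst) auto
        also have "\<dots> = (integral\<^sup>L \<mu> f)\<^sup>2" by (rule independent)
        also have "\<dots> \<le> ?q\<^sup>2"
        proof (rule power_mono)
          have "integral\<^sup>L \<mu> f \<le> integral\<^sup>L \<mu> (indicator U)"
          proof (rule integral_mono[OF _ _ f(3)])
            have "f \<in> borel_measurable \<mu>" using f_m by (simp add: measurable_cong_sets[OF s\<mu> refl])
            then show "integrable \<mu> f" using f1 f(2) by (intro \<mu>.integrable_const_bound[of f 1]) auto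
            show "integrable \<mu> (indicator U :: 'x \<Rightarrow> real)"
              using U s\<mu> by (simp add: integrable_real_indicator less_top[symmetric])
          qed
          then show "integral\<^sup>L \<mu> f \<le> ?q"
            using U s\<mu> sets.sets_into_space[of U \<mu>] by (simp add: Int_absorb2)
        qed (use f in \<open>auto intro: integral_nonneg_AE\<close>)
        finally show ?thesis using e by simp
      next
        case (graph g h)
        have m2: "(\<lambda>x. (act g x, act h x)) \<in> measurable \<mu> borel"
          unfolding measurable_cong_sets[OF s\<mu> refl] by (intro borel_measurable_Pair) auto
        have eq: "integral\<^sup>L \<rho> \<Phi> = integral\<^sup>L \<mu> (\<lambda>x. \<Phi> (act g x, act h x))"
          unfolding graph by (rule integral_distr[OF m2 borel_measurable_continuous_onI[OF \<Phi>_c]])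
        show ?thesis
        proof (cases "h - g \<in> S")
          case True
          have "\<Phi> (act g x, act h x) = 0" for x
          proof -
            have "act (h - g) (act g x) = act h x" using act_add[of "h - g" g x] by simp
            then have "\<theta> (act g x, act h x) = 0"
              unfolding \<theta>_def using S(1) True by (intro prod_zero bexI[of _ "h - g"]) auto
            then show ?thesis by (simp add: \<Phi>_def)
          qed
          then show ?thesis using eq e by simp
        next
          case False
          let ?A = "{x. act g x \<in> U \<and> act h x \<in> U}"
          have A: "?A \<in> sets \<mu>"
          proof -
            have "?A = act g -` U \<inter> act h -` U" by auto
            then show ?thesis using measurable_sets[OF act_m U] s\<mu> by auto
          qed
          have "integral\<^sup>L \<mu> (\<lambda>x. \<Phi> (act g x, act h x)) \<le> integral\<^sup>L \<mu> (indicator ?A)"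
          proof (rule integral_mono)
            have "(\<lambda>x. \<Phi> (act g x, act h x)) \<in> borel_measurable \<mu>"
              by (rule measurable_compose[OF m2 borel_measurable_continuous_onI[OF \<Phi>_c]])
            then show "integrable \<mu> (\<lambda>x. \<Phi> (act g x, act h x))"
              using \<Phi>_le(2) order_trans[OF \<Phi>_le(1) ff_le] by (intro \<mu>.integrable_const_bound[of _ 1]) auto
            show "integrable \<mu> (indicator ?A :: 'x \<Rightarrow> real)"
              using A by (simp add: integrable_real_indicator less_top[symmetric])
            show "\<Phi> (act g x, act h x) \<le> indicator ?A x" for x
            proof (cases "x \<in> ?A")
              case True
              then show ?thesis using order_trans[OF \<Phi>_le(1) ff_le] by simp
            next
              case False
              then have "f (act g x) = 0 \<or> f (act h x) = 0" using fU by blast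
              then show ?thesis using False by (auto simp: \<Phi>_def)
            qed
          qed
          also have "\<dots> = measure \<mu> ?A"
            using A sets.sets_into_space[OF A] by (simp add: Int_absorb2)
          also have "\<dots> \<le> ?q\<^sup>2 + e/3" by (rule S(2)[OF False])
          finally show ?thesis using eq by simp
        qed
      qed
    qed
    then have "eventually (\<lambda>n. average (F n) (\<lambda>g. \<Phi> (pair_act act g (x, y))) \<le> (?q\<^sup>2 + e/3) + e/3) sequentially"
      using e by (intro folner_average_le_ergodic_bound[OF compact2 continuous_action_pair_act[OF act] F \<Phi>_c]) auto
    moreover have "eventually (\<lambda>n. \<forall>s\<in>S. average (F n)
        (\<lambda>g. of_bool (dist (act g (act s x)) (act g y) < \<epsilon> s)) \<le> \<delta>) sequentially"
      using S(1) \<epsilon>(2) by (simp add: eventually_ball_finite_distrib)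
    ultimately show "eventually (\<lambda>n. average (F n) (\<lambda>g. f (act g x) * f (act g y)) \<le> ?q\<^sup>2 + e) sequentially"
    proof eventually_elim
      case (elim n)
      have commute: "act s (act g x) = act g (act s x)" for s g
        using act_add[of s g x] act_add[of g s x] by (simp add: add.commute)
      have "f (act g x) * f (act g y) \<le> \<Phi> (pair_act act g (x, y)) +
          (\<Sum>s\<in>S. of_bool (dist (act g (act s x)) (act g y) < \<epsilon> s))" for g
      proof (cases "\<exists>s\<in>S. dist (act g (act s x)) (act g y) < \<epsilon> s")
        case True
        then obtain s where s: "s \<in> S" "dist (act g (act s x)) (act g y) < \<epsilon> s" by blast
        have "of_bool (dist (act g (act s x)) (act g y) < \<epsilon> s)
            \<le> (\<Sum>s\<in>S. of_bool (dist (act g (act s x)) (act g y) < \<epsilon> s) :: real)"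
          using S(1) s(1) by (intro member_le_sum) auto
        then show ?thesis using s(2) ff_le[of "act g x" "act g y"] \<Phi>_le(2)[of "pair_act act g (x, y)"] by simp
      next
        case False
        have "\<theta> (pair_act act g (x, y)) = 1"
          unfolding \<theta>_def using False \<epsilon>(1)
          by (intro prod.neutral) (auto simp: pair_act_def commute min_def not_less le_divide_eq)
        then show ?thesis by (simp add: \<Phi>_def pair_act_def sum_nonneg)
      qed
      then have "average (F n) (\<lambda>g. f (act g x) * f (act g y)) \<le>
          average (F n) (\<lambda>g. \<Phi> (pair_act act g (x, y)) +
            (\<Sum>s\<in>S. of_bool (dist (act g (act s x)) (act g y) < \<epsilon> s)))"
        by (rule average_mono)
      also have "\<dots> \<le> ((?q\<^sup>2 + e/3) + e/3) + (\<Sum>s\<in>S. \<delta>)"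
        unfolding average_add average_sum using elim by (intro add_mono sum_mono) auto
      also have "(\<Sum>s\<in>S. \<delta>) \<le> e/3"
        using e by (simp add: \<delta>_def field_simps)
      finally show ?case by simp
    qed
  qed
qed

section \<open>Orbits of infinite sets\<close>

text \<open>
  The points are chosen one after the other, each outside the finite exceptional sets of its
  predecessors. Avoiding predecessors is enough for the pairwise correlation bounds, because the
  correlation of two points is symmetric.
\<close>
lemma infinite_set_avoiding_sequence:
  assumes "infinite K" "\<And>x. finite (bad x)"
  shows "\<exists>xs :: nat \<Rightarrow> 'x. \<forall>j<N. xs j \<in> K \<and> (\<forall>i<j. xs j \<notin> bad (xs i))"
proof (induction N)
  case (Suc N)
  then obtain xs :: "nat \<Rightarrow> 'x" where xs: "\<And>j. j < N \<Longrightarrow> xs j \<in> K \<and> (\<forall>i<j. xs j \<notin> bad (xs i))" by blast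
  have "finite (\<Union>i<N. bad (xs i))" using assms(2) by simp
  then have "infinite (K - (\<Union>i<N. bad (xs i)))" using assms(1) by (rule Diff_infinite_finite)
  then have "K - (\<Union>i<N. bad (xs i)) \<noteq> {}" by (rule infinite_imp_nonempty)
  then obtain y where "y \<in> K - (\<Union>i<N. bad (xs i))" by blast
  then have y: "y \<in> K" "\<And>i. i < N \<Longrightarrow> y \<notin> bad (xs i)" by auto
  have "(xs(N := y)) j \<in> K \<and> (\<forall>i<j. (xs(N := y)) j \<notin> bad ((xs(N := y)) i))" if "j < Suc N" for j
    using that xs[of j] y by (cases "j = N") auto
  then show ?case by blast
qed simp

text \<open>By minimality the countably many preimages of \<open>U\<close> under the group cover the space.\<close>
lemma invariant_measure_open_pos:
  fixes act :: "'g::{group_add, countable} \<Rightarrow> 'x::topological_space \<Rightarrow> 'x"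
  assumes inv: "invariant_prob borel act \<mu>" and min: "minimal_action act"
    and U: "open U" "U \<noteq> {}"
  shows "measure \<mu> U > 0"
proof (rule ccontr)
  assume "\<not> measure \<mu> U > 0"
  then have 0: "measure \<mu> U = 0" using measure_nonneg[of \<mu> U] by linarith
  interpret prob_space \<mu> using inv by (simp add: invariant_prob_def)
  have s: "sets \<mu> = sets borel" using inv by (simp add: invariant_prob_def)
  have sp: "space \<mu> = UNIV" using sets_eq_imp_space_eq[OF s] by simp
  have null: "act g -` U \<in> null_sets \<mu>" for g
  proof -
    have m: "act g \<in> measurable \<mu> borel" "distr \<mu> borel (act g) = \<mu>"
      using inv by (auto simp: invariant_prob_def measurable_cong_sets[OF s refl])
    have "measure \<mu> (act g -` U) = 0"
      using measure_distr[OF m(1), of U] U(1) m(2) 0 sp by simp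
    then show ?thesis
      using measurable_sets[OF m(1), of U] U(1) sp by (auto simp: emeasure_eq_measure)
  qed
  have "\<exists>g. x \<in> act g -` U" for x
  proof -
    have "closure (range (\<lambda>g. act g x)) = UNIV" using min by (simp add: minimal_action_def)
    then have "U \<inter> range (\<lambda>g. act g x) \<noteq> {}"
      using open_Int_closure_eq_empty[OF U(1), of "range (\<lambda>g. act g x)"] U(2) by auto
    then show ?thesis by auto
  qed
  then have "(\<Union>g. act g -` U) = space \<mu>" by (auto simp: sp)
  moreover have "(\<Union>g. act g -` U) \<in> null_sets \<mu>"
    by (rule null_sets_UN') (simp_all add: null)
  ultimately show False using emeasure_space_1 null_setsD1 by fastforce
qed

text \<open>
  The second moment argument. Let \<open>Z g\<close> be the mean of \<open>f (g (x i))\<close> over \<open>N + 1\<close> points of \<open>K\<close> with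
  small pairwise correlations. The average of \<open>(Z g - p)\<^sup>2\<close> is eventually less than \<open>t = (e/2) * (q/2)\<^sup>2\<close>, where
  \<open>p = \<integral> f d\<mu> > q/2\<close>, whereas \<open>(Z g - p)\<^sup>2 = p\<^sup>2\<close> whenever \<open>gK\<close> misses \<open>U\<close>.
\<close>
theorem infinite_set_misses_open_set_rarely:
  fixes act :: "'g::{ab_group_add, countable} \<Rightarrow> 'x::compact_metric_space \<Rightarrow> 'x"
  assumes act: "continuous_action act" and inv: "invariant_prob borel act \<mu>"
    and F: "folner_sequence F" and min: "minimal_action act"
    and unique: "\<And>\<nu>. invariant_prob borel act \<nu> \<Longrightarrow> \<nu> = \<mu>"
    and mix: "mixing_all_orders act \<mu>" and msj: "minimal_self_joinings act \<mu>"
    and nwa: "\<And>x y. \<not> weakly_asymptotic F act x y"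
    and U: "open U" "U \<noteq> {}" and K: "infinite K"
  shows "(\<lambda>n. average (F n) (\<lambda>g. of_bool (act g ` K \<inter> U = {}))) \<longlonglongrightarrow> 0"
proof (rule tendstoI)
  fix e :: real assume e: "e > 0"
  define q where "q = measure \<mu> U"
  interpret \<mu>: prob_space \<mu> using inv by (simp add: invariant_prob_def)
  have s\<mu>: "sets \<mu> = sets borel" using inv by (simp add: invariant_prob_def)
  have fin: "finite (F n)" "F n \<noteq> {}" for n using F by (auto simp: folner_sequence_def)
  have q: "0 < q" "q \<le> 1"
    using invariant_measure_open_pos[OF inv min U] by (simp_all add: q_def)
  define t where "t = (e/2) * (q/2)\<^sup>2"
  have t: "t > 0" using e q by (simp add: t_def)
  obtain fs :: "nat \<Rightarrow> 'x \<Rightarrow> real" where fs: "\<And>n. continuous_on UNIV (fs n)" "\<And>n z. 0 \<le> fs n z"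
    "\<And>n z. fs n z \<le> indicator U z" "\<And>z. (\<lambda>n. fs n z) \<longlonglongrightarrow> indicator U z"
    by (rule open_indicator_limit[OF U(1)]) (rule that)
  have "(\<lambda>n. integral\<^sup>L \<mu> (fs n)) \<longlonglongrightarrow> q"
    unfolding q_def by (rule open_indicator_integral_limit[OF _ s\<mu> U(1) fs]) (rule \<mu>.prob_space_axioms)
  \<comment> \<open>the margin \<open>q/2\<close> keeps \<open>p\<close> away from \<open>0\<close>, the margin \<open>t/6\<close> gives \<open>q\<^sup>2 - p\<^sup>2 \<le> t/3\<close>\<close>
  moreover have "q - min (q/2) (t/6) < q" using q t by simp
  ultimately have "eventually (\<lambda>n. q - min (q/2) (t/6) < integral\<^sup>L \<mu> (fs n)) sequentially"
    by (rule order_tendstoD(1))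
  then obtain k where k: "q - min (q/2) (t/6) < integral\<^sup>L \<mu> (fs k)"
    by (auto simp: eventually_sequentially)
  define f where "f = fs k"
  define p where "p = integral\<^sup>L \<mu> f"
  have f: "continuous_on UNIV f" "\<And>x. 0 \<le> f x" "\<And>x. f x \<le> indicator U x"
    using fs by (simp_all add: f_def)
  have f1: "f x \<le> 1" for x by (rule order_trans[OF f(3) indicator_le_1])
  have fU: "f x = 0" if "x \<notin> U" for x using f(2)[of x] f(3)[of x] that by simp
  have p_le: "p \<le> 1"
    unfolding p_def using f1 f(2) f(1)
    by (intro \<mu>.integral_le_const \<mu>.integrable_const_bound[of f 1])
      (auto simp: measurable_cong_sets[OF s\<mu> refl] intro: borel_measurable_continuous_onI)
  have p: "q/2 < p" "q - t/6 < p" using k by (auto simp: p_def f_def)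
  have qp: "q\<^sup>2 - p\<^sup>2 \<le> t/3"
  proof (cases "q \<le> p")
    case True
    then have "q\<^sup>2 \<le> p\<^sup>2" using q by (intro power_mono) auto
    then show ?thesis using t by simp
  next
    case False
    have "q\<^sup>2 - p\<^sup>2 = (q - p) * (q + p)" by (simp add: power2_eq_square algebra_simps)
    also have "\<dots> \<le> (t/6) * 2" using False p q p_le by (intro mult_mono) auto
    finally show ?thesis by simp
  qed
  have t9: "t/9 > 0" using t by simp
  have "\<exists>S. finite S \<and> (\<forall>x y. y \<notin> (\<lambda>s. act s x) ` S \<longrightarrow>
       eventually (\<lambda>n. average (F n) (\<lambda>g. f (act g x) * f (act g y)) \<le> q\<^sup>2 + t/9) sequentially)"
    unfolding q_def
    by (rule pair_average_bound[OF act inv F unique mix msj nwa borel_open[OF U(1)] f t9]) (assumption, blast)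
  then obtain S where S: "finite S" "\<And>x y. y \<notin> (\<lambda>s. act s x) ` S \<Longrightarrow>
       eventually (\<lambda>n. average (F n) (\<lambda>g. f (act g x) * f (act g y)) \<le> q\<^sup>2 + t/9) sequentially"
    by blast
  obtain N where N: "1 / real (Suc N) < t/3" using nat_approx_posE[of "t/3"] t by auto
  let ?N = "real (Suc N)"
  obtain xs where xs: "\<And>j. j < Suc N \<Longrightarrow> xs j \<in> K \<and> (\<forall>i<j. xs j \<notin> (\<lambda>s. act s (xs i)) ` S)"
    using infinite_set_avoiding_sequence[OF K, of "\<lambda>x. (\<lambda>s. act s x) ` S" "Suc N"] S(1) by auto
  define a where "a i g = f (act g (xs i))" for i g
  have a: "0 \<le> a i g" "a i g \<le> 1" for i g using f(2) f1 by (simp_all add: a_def)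
  \<comment> \<open>the diagonal terms are bounded by \<open>1\<close> only, but contribute at most \<open>1 / (N + 1) < t/3\<close> to the mean over all pairs\<close>
  have cross: "eventually (\<lambda>n. average (F n) (\<lambda>g. a i g * a j g) \<le> of_bool (i = j) + (q\<^sup>2 + t/9)) sequentially"
    if "i < Suc N" "j < Suc N" for i j
  proof -
    consider "i = j" | "i < j" | "j < i" by linarith
    then show ?thesis
    proof cases
      case 1
      have "average (F n) (\<lambda>g. a i g * a j g) \<le> 1 + (q\<^sup>2 + t/9)" for n
      proof -
        have "average (F n) (\<lambda>g. a i g * a j g) \<le> average (F n) (\<lambda>_. 1)"
          using a by (intro average_mono mult_le_one) auto
        moreover have "0 \<le> q\<^sup>2 + t/9" using t by simp
        ultimately show ?thesis using average_const[OF fin, of n 1] by linarith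
      qed
      then show ?thesis using 1 by simp
    next
      case 2
      then show ?thesis using S(2)[of "xs j" "xs i"] xs that by (simp add: a_def)
    next
      case 3
      then show ?thesis using S(2)[of "xs i" "xs j"] xs that by (simp add: a_def mult.commute)
    qed
  qed
  have mean: "eventually (\<lambda>n. p - t/9 < average (F n) (a i)) sequentially" for i
    unfolding p_def a_def[abs_def]
    using order_tendstoD(1)[OF uniquely_ergodic_average_tendsto[OF compact_UNIV_metric act F f(1) unique]] t by simp
  have "eventually (\<lambda>n. (\<forall>i\<in>{..<Suc N}. \<forall>j\<in>{..<Suc N}.
      average (F n) (\<lambda>g. a i g * a j g) \<le> of_bool (i = j) + (q\<^sup>2 + t/9)) \<and>
      (\<forall>i\<in>{..<Suc N}. p - t/9 < average (F n) (a i))) sequentially"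
    using cross mean by (simp add: eventually_conj_iff eventually_ball_finite_distrib del: lessThan_Suc)
  then show "eventually (\<lambda>n. dist (average (F n) (\<lambda>g. of_bool (act g ` K \<inter> U = {}))) 0 < e) sequentially"
  proof eventually_elim
    case (elim n)
    define Z where "Z g = (\<Sum>i<Suc N. a i g) / ?N" for g
    have "average (F n) (\<lambda>g. (Z g)\<^sup>2) = (\<Sum>i<Suc N. \<Sum>j<Suc N. average (F n) (\<lambda>g. a i g * a j g)) / ?N\<^sup>2"
    proof -
      have "(Z g)\<^sup>2 = (1 / ?N\<^sup>2) * (\<Sum>i<Suc N. \<Sum>j<Suc N. a i g * a j g)" for g
        by (simp add: Z_def power2_eq_square sum_product del: sum.lessThan_Suc)
      then show ?thesis by (simp only: average_divide average_sum times_divide_eq_left mult_1)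
    qed
    also have "\<dots> \<le> (\<Sum>i<Suc N. \<Sum>j<Suc N. of_bool (i = j) + (q\<^sup>2 + t/9)) / ?N\<^sup>2"
      using elim by (intro divide_right_mono sum_mono) (auto simp del: lessThan_Suc)
    also have "(\<Sum>i<Suc N. \<Sum>j<Suc N. of_bool (i = j) + (q\<^sup>2 + t/9)) = ?N + ?N\<^sup>2 * (q\<^sup>2 + t/9)"
    proof -
      have row: "(\<Sum>j<Suc N. of_bool (i = j) + (q\<^sup>2 + t/9)) = 1 + ?N * (q\<^sup>2 + t/9)" if "i < Suc N" for i
      proof -
        have "{..<Suc N} \<inter> {j. i = j} = {i}" using that by auto
        then have "(\<Sum>j<Suc N. of_bool (i = j)) = (1::real)" by (simp del: sum.lessThan_Suc lessThan_Suc)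
        then show ?thesis by (simp only: sum.distrib sum_constant card_lessThan distrib_left)
      qed
      have "(\<Sum>i<Suc N. \<Sum>j<Suc N. of_bool (i = j) + (q\<^sup>2 + t/9)) = (\<Sum>i<Suc N. 1 + ?N * (q\<^sup>2 + t/9))"
        by (intro sum.cong refl row) simp
      also have "\<dots> = ?N * (1 + ?N * (q\<^sup>2 + t/9))" by (simp only: sum_constant card_lessThan)
      finally show ?thesis by (simp only: power2_eq_square distrib_left mult_1_right mult.assoc)
    qed
    also have "(?N + ?N\<^sup>2 * (q\<^sup>2 + t/9)) / ?N\<^sup>2 = 1 / ?N + (q\<^sup>2 + t/9)"
      by (simp add: add_divide_distrib power2_eq_square del: of_nat_Suc)
    finally have Z2: "average (F n) (\<lambda>g. (Z g)\<^sup>2) \<le> 1 / ?N + (q\<^sup>2 + t/9)" .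
    have Z1: "p - t/9 \<le> average (F n) Z"
    proof -
      have "average (F n) Z = (\<Sum>i<Suc N. average (F n) (a i)) / ?N"
        unfolding Z_def[abs_def] by (simp only: average_divide average_sum)
      moreover have "(\<Sum>i<Suc N. p - t/9) \<le> (\<Sum>i<Suc N. average (F n) (a i))"
        using elim by (intro sum_mono less_imp_le) (auto simp del: lessThan_Suc)
      ultimately show ?thesis by (simp add: le_divide_eq mult.commute del: sum.lessThan_Suc)
    qed
    have "average (F n) (\<lambda>g. p\<^sup>2 * of_bool (act g ` K \<inter> U = {})) \<le> average (F n) (\<lambda>g. (Z g - p)\<^sup>2)"
    proof (rule average_mono)
      fix g
      show "p\<^sup>2 * of_bool (act g ` K \<inter> U = {}) \<le> (Z g - p)\<^sup>2"
      proof (cases "act g ` K \<inter> U = {}")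
        case True
        then have "a i g = 0" if "i < Suc N" for i
          unfolding a_def using xs[OF that] by (intro fU) blast
        then have "Z g = 0" by (simp add: Z_def del: sum.lessThan_Suc)
        then show ?thesis by simp
      qed simp
    qed
    also have "\<dots> = average (F n) (\<lambda>g. (Z g)\<^sup>2) - 2 * p * average (F n) Z + p\<^sup>2"
    proof -
      have "(\<lambda>g. (Z g - p)\<^sup>2) = (\<lambda>g. ((Z g)\<^sup>2 - 2 * p * Z g) + p\<^sup>2)"
        by (simp add: fun_eq_iff power2_eq_square algebra_simps)
      then show ?thesis by (simp add: average_add average_diff average_cmult average_const[OF fin])
    qed
    also have "\<dots> \<le> (1 / ?N + (q\<^sup>2 + t/9)) - 2 * p * (p - t/9) + p\<^sup>2"
      using Z1 Z2 p q by (intro add_mono diff_mono mult_left_mono) auto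
    also have "\<dots> = 1 / ?N + (q\<^sup>2 - p\<^sup>2) + t/9 + 2 * p * t/9"
      by (simp add: power2_eq_square algebra_simps)
    also have "\<dots> < t/3 + t/3 + t/9 + 2 * t/9"
    proof -
      have "2 * p * t \<le> 2 * t" using p_le t by simp
      then show ?thesis using N qp by simp
    qed
    finally have "p\<^sup>2 * average (F n) (\<lambda>g. of_bool (act g ` K \<inter> U = {})) < t" by (simp add: average_cmult)
    moreover have "t \<le> p\<^sup>2 * (e/2)"
      unfolding t_def using p q e by (subst mult.commute, intro mult_right_mono power_mono) auto
    ultimately have "p\<^sup>2 * average (F n) (\<lambda>g. of_bool (act g ` K \<inter> U = {})) < p\<^sup>2 * (e/2)" by linarith
    then have "average (F n) (\<lambda>g. of_bool (act g ` K \<inter> U = {})) < e/2"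
      by (rule mult_left_less_imp_less) simp
    moreover have "0 \<le> average (F n) (\<lambda>g. of_bool (act g ` K \<inter> U = {}))" by (rule average_nonneg) simp
    ultimately show ?case using e by simp
  qed
qed

lemma closed_hyperspace_disjoint_open:
  fixes U :: "'x::metric_space set"
  assumes "open U"
  shows "closed {K :: 'x hyperspace. set_of_hyperspace K \<inter> U = {}}"
proof -
  have "open {K :: 'x hyperspace. set_of_hyperspace K \<inter> U \<noteq> {}}"
    unfolding open_dist
  proof (intro ballI)
    fix K :: "'x hyperspace" assume "K \<in> {K. set_of_hyperspace K \<inter> U \<noteq> {}}"
    then obtain x where x: "x \<in> set_of_hyperspace K" "x \<in> U" by blast
    then obtain e where e: "e > 0" "ball x e \<subseteq> U" using assms by (meson openE)
    have "L \<in> {K. set_of_hyperspace K \<inter> U \<noteq> {}}" if "dist L K < e" for L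
    proof -
      have "dist K L < e" using that by (simp add: dist_commute)
      then obtain y where "y \<in> set_of_hyperspace L" "dist x y < e"
        by (rule hyperspace_nearby[OF x(1)])
      then show ?thesis using e(2) by auto
    qed
    then show "\<exists>e>0. \<forall>L. dist L K < e \<longrightarrow> L \<in> {K. set_of_hyperspace K \<inter> U \<noteq> {}}" using e(1) by blast
  qed
  then show ?thesis by (simp add: closed_def Compl_eq)
qed

lemma borel_finite_hyperspace:
  "{K :: 'x::metric_space hyperspace. finite (set_of_hyperspace K)} \<in> sets borel"
proof -
  have "(\<Union>n. {K :: 'x hyperspace. finite (set_of_hyperspace K) \<and> card (set_of_hyperspace K) \<le> n}) \<in> sets borel"
    by (intro sets.countable_UN) (auto intro: borel_closed closed_card_le_hyperspace)
  moreover have "(\<Union>n. {K :: 'x hyperspace. finite (set_of_hyperspace K) \<and> card (set_of_hyperspace K) \<le> n})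
      = {K. finite (set_of_hyperspace K)}" by auto
  ultimately show ?thesis by simp
qed

theorem theorem5:
  fixes act :: "'g::{ab_group_add, countable} \<Rightarrow> 'x::compact_metric_space \<Rightarrow> 'x"
    and \<mu> :: "'x measure"
    and F :: "nat \<Rightarrow> 'g set"
  assumes "continuous_action act"
    and "invariant_prob borel act \<mu>"
    and "folner_sequence F" and "tempered F"
    and "minimal_action act"
    and "uniquely_ergodic act"
    and "mixing_all_orders act \<mu>"
    and "minimal_self_joinings act \<mu>"
    and "\<not> (\<exists>x y. weakly_asymptotic F act x y)"
  shows "IC_rigid act"
  unfolding IC_rigid_def
proof (intro allI impI)
  fix \<nu> :: "'x hyperspace measure"
  let ?T = "\<lambda>g. image_hyperspace (act g)"
  assume \<nu>: "invariant_prob borel ?T \<nu>"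
  interpret \<nu>: prob_space \<nu> using \<nu> by (simp add: invariant_prob_def)
  have s\<nu>: "sets \<nu> = sets borel" using \<nu> by (simp add: invariant_prob_def)
  have sp\<nu>: "space \<nu> = UNIV" using sets_eq_imp_space_eq[OF s\<nu>] by simp
  have T_m: "?T g \<in> measurable \<nu> borel" and T_\<nu>: "distr \<nu> borel (?T g) = \<nu>" for g
    using \<nu> by (auto simp: invariant_prob_def measurable_cong_sets[OF s\<nu> refl])
  have unique: "\<nu>' = \<mu>" if "invariant_prob borel act \<nu>'" for \<nu>'
    using assms(2,6) that by (auto simp: uniquely_ergodic_def)
  have nwa: "\<not> weakly_asymptotic F act x y" for x y using assms(9) by simp
  have act: "act 0 x = x" "act (g + h) x = act g (act h x)" "continuous_on UNIV (act g)" for g h x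
    using assms(1) by (auto simp: continuous_action_def)
  have inj: "inj (act g)" for g
    by (rule inj_on_inverseI[of _ "act (- g)"]) (simp add: act(1) act(2)[symmetric])
  have T_set: "set_of_hyperspace (?T g K) = act g ` set_of_hyperspace K" for g K
    by (rule set_of_image_hyperspace[OF act(3)])
  have fin: "finite (F n)" "F n \<noteq> {}" for n using assms(3) by (auto simp: folner_sequence_def)
  define E where "E U = {K :: 'x hyperspace. infinite (set_of_hyperspace K) \<and> set_of_hyperspace K \<inter> U = {}}" for U
  have E_sets: "E U \<in> sets borel" if "open U" for U
  proof -
    have "E U = {K. set_of_hyperspace K \<inter> U = {}} - {K. finite (set_of_hyperspace K)}" by (auto simp: E_def)
    then show ?thesis
      using borel_closed[OF closed_hyperspace_disjoint_open[OF that]] borel_finite_hyperspace by auto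
  qed
  have null: "measure \<nu> (E U) = 0" if U: "open U" "U \<noteq> {}" for U
  proof -
    have E: "E U \<in> sets \<nu>" using E_sets[OF U(1)] s\<nu> by simp
    have TE: "?T g -` E U \<in> sets \<nu>" for g using measurable_sets[OF T_m E_sets[OF U(1)], of g] sp\<nu> by simp
    have meas_TE: "measure \<nu> (?T g -` E U) = measure \<nu> (E U)" for g
      using measure_distr[OF T_m E_sets[OF U(1)], of g] T_\<nu> sp\<nu> by simp
    define b where "b n K = average (F n) (\<lambda>g. indicator (?T g -` E U) K)" for n K
    have b_int: "integral\<^sup>L \<nu> (b n) = measure \<nu> (E U)" for n
    proof -
      have "integral\<^sup>L \<nu> (b n) = average (F n) (\<lambda>g. measure \<nu> (?T g -` E U))"
        unfolding b_def[abs_def] average_def using TE sp\<nu>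
        by (subst integral_divide_zero, subst Bochner_Integration.integral_sum)
           (auto simp: integrable_real_indicator less_top[symmetric])
      then show ?thesis using average_const[OF fin] by (simp add: meas_TE)
    qed
    have b_lim: "(\<lambda>n. b n K) \<longlonglongrightarrow> 0" for K
    proof (cases "finite (set_of_hyperspace K)")
      case True
      then show ?thesis by (simp add: b_def E_def T_set average_def)
    next
      case False
      have "(\<lambda>n. average (F n) (\<lambda>g. of_bool (act g ` set_of_hyperspace K \<inter> U = {}))) \<longlonglongrightarrow> 0"
        by (rule infinite_set_misses_open_set_rarely[OF assms(1,2,3,5) unique assms(7,8) nwa U False])
      moreover have "indicator (?T g -` E U) K = (of_bool (act g ` set_of_hyperspace K \<inter> U = {}) :: real)" for g
        using False finite_image_iff[OF inj_on_subset[OF inj subset_UNIV]] by (auto simp: E_def T_set indicator_def)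
      ultimately show ?thesis by (simp add: b_def)
    qed
    have b_bound: "norm (b n K) \<le> 1" for n K
    proof -
      have "b n K \<le> average (F n) (\<lambda>_. 1)" unfolding b_def by (rule average_mono) (simp add: indicator_le_1)
      moreover have "0 \<le> b n K" unfolding b_def by (rule average_nonneg) simp
      ultimately show ?thesis using average_const[OF fin, of n 1] by simp
    qed
    have "b n \<in> borel_measurable \<nu>" for n
      unfolding b_def[abs_def] average_def using TE by (intro borel_measurable_divide borel_measurable_sum) auto
    then have "(\<lambda>n. integral\<^sup>L \<nu> (b n)) \<longlonglongrightarrow> integral\<^sup>L \<nu> (\<lambda>_. 0)"
      using b_lim b_bound by (intro integral_dominated_convergence[where w = "\<lambda>_. 1"]) auto
    then show ?thesis by (simp add: b_int LIMSEQ_const_iff)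
  qed
  obtain B :: "'x set set" where B: "countable B" "topological_basis B"
    using ex_countable_basis by blast
  have "AE K in \<nu>. K \<notin> E U" if "U \<in> B - {{}}" for U
    using that null[of U] E_sets[of U] topological_basis_open[OF B(2), of U] s\<nu>
    by (intro AE_not_in) (auto simp: \<nu>.emeasure_eq_measure)
  then have "AE K in \<nu>. \<forall>U\<in>B - {{}}. K \<notin> E U"
    using B(1) by (simp add: AE_ball_countable)
  then have AE: "AE K in \<nu>. K \<in> {K. finite (set_of_hyperspace K) \<or> set_of_hyperspace K = UNIV}"
  proof eventually_elim
    case (elim K)
    show ?case
    proof (rule ccontr)
      assume "K \<notin> {K. finite (set_of_hyperspace K) \<or> set_of_hyperspace K = UNIV}"
      then obtain x where x: "infinite (set_of_hyperspace K)" "x \<in> - set_of_hyperspace K" by auto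
      have "open (- set_of_hyperspace K)" by (simp add: open_Compl compact_imp_closed)
      then obtain U where "U \<in> B" "x \<in> U" "U \<subseteq> - set_of_hyperspace K"
        using topological_basisE[OF B(2) _ x(2)] by metis
      then have "U \<in> B - {{}}" "K \<in> E U" using x(1) by (auto simp: E_def)
      then show False using elim by blast
    qed
  qed
  show "measure \<nu> {K. finite (set_of_hyperspace K) \<or> set_of_hyperspace K = UNIV} = 1"
    using AE borel_finite_or_UNIV_hyperspace[where 'a = 'x] s\<nu> by (subst \<nu>.prob_eq_1) auto
qed

end
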